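(* Let $T$ and $\hat T$ be the exact and hybrid random-scan Gibbs kernels on $\mathsf X=\mathsf X_1\times\cdots\times\mathsf X_n$ targeting $\Pi$ (defined in the context). Suppose that there exist constants $c_1,c_2\in(0,2)$ such that $$c_1\le \frac{\mathcal E_{Q_{i,y}}(g)}{\|g\|_{\Pi_{i,y}}^2}\le c_2$$ for $i=1,\dots,n$, $M_{-i}$-a.e. $y\in\mathsf X_{-i}$, and every $g\in L_0^2(\Pi_{i,y})\setminus\{0\}$. Assume further that $\|T\|_\Pi<1$. Then, for every $f\in L_0^2(\Pi)$, $$c_2^{-1}\,\mathrm{var}_T(f)+(c_2^{-1}-1)\|f\|_\Pi^2\le \mathrm{var}_{\hat T}(f)\le c_1^{-1}\,\mathrm{var}_T(f)+(c_1^{-1}-1)\|f\|_\Pi^2.$$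
   Context: $L^2$ conventions. For a probability space $(\mathsf Y,\mathcal F,\omega)$, $L^2(\omega)$ is the real Hilbert space of square-integrable functions (modulo a.e. equality) with inner product $\langle f,g\rangle_\omega=\int fg\,d\omega$ and norm $\|\cdot\|_\omega$; $L_0^2(\omega)=\{f\in L^2(\omega):\int f\,d\omega=0\}$. A Markov transition kernel (Mtk) $K$ on $\mathsf Y$ reversible with respect to $\omega$ acts as a self-adjoint operator on $L_0^2(\omega)$ by $Kf(y)=\int K(y,dy')f(y')$; $\|K\|_\omega\in[0,1]$ is its operator norm on $L_0^2(\omega)$. Its Dirichlet form is, for $f\in L^2(\omega)$, $\mathcal E_K(f)=\|f-\omega f\|_\omega^2-\langle f-\omega f,K(f-\omega f)\rangle_\omega=\tfrac12\int\int\omega(dy)K(y,dy')[f(y)-f(y')]^2$, where $\omega f=\int f\,d\omega$. The asymptotic variance of $f\in L^2(\omega)$ is $\mathrm{var}_K(f)=\lim_{t\to\infty}t^{-1}\,\mathrm{var}\big[\sum_{s=1}^t f(X(s))\big]$, where $(X(s))_{s\ge0}$ is the chain with kernel $K$ and $X(0)\sim\omega$; when $\|K\|_\omega<1$ and $f\in L_0^2(\omega)$, it equals $2\langle f,(I-K)^{-1}f\rangle_\omega-\|f\|_\omega^2$, with $I$ the identity on $L_0^2(\omega)$. Gibbs setting. $(\mathsf X,\mathcal B)$ is the product of Polish spaces $\mathsf X_1,\dots,\mathsf X_n$ with Borel $\sigma$-algebras $\mathcal B_1,\dots,\mathcal B_n$, and $\Pi$ is a probability measure on $(\mathsf X,\mathcal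 B)$. For $x\in\mathsf X$, $x_{-i}$ is $x$ with the $i$th component removed, $\mathsf X_{-i}=\{x_{-i}:x\in\mathsf X\}$. For $X\sim\Pi$, $M_{-i}$ is the distribution of $X_{-i}$ and $\Pi_{i,y}$ is the conditional distribution of $X_i$ given $X_{-i}=y$. For each $i$ and $y\in\mathsf X_{-i}$, $Q_{i,y}:\mathsf X_i\times\mathcal B_i\to[0,1]$ is an Mtk reversible with respect to $\Pi_{i,y}$, and for every $i$ and $A\in\mathcal B_i$ the map $x\mapsto Q_{i,x_{-i}}(x_i,A)$ is measurable. Let $p_1,\dots,p_n\ge0$ with $\sum_i p_i=1$, and let $\delta$ denote a point mass. Define $$T(x,dx')=\sum_{i=1}^n p_i\,\Pi_{i,x_{-i}}(dx_i')\,\delta_{x_{-i}}(dx_{-i}'),\qquad \hat T(x,dx')=\sum_{i=1}^n p_i\,Q_{i,x_{-i}}(x_i,dx_i')\,\delta_{x_{-i}}(dx_{-i}').$$ Both are reversible with respect to $\Pi$. *)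

theory Defs
  imports "HOL-Probability.Probability"
begin

text \<open>Polish spaces are abstract topologies rather than instances of the type class
  \<^class>\<open>polish_space\<close>, so that the factors of a product may be different spaces carried by a
  common type.\<close>

definition polish_topology :: "'a topology \<Rightarrow> bool" where
  "polish_topology X \<longleftrightarrow> completely_metrizable_space X \<and> separable_space X"

definition borel_of_topology :: "'a topology \<Rightarrow> 'a measure" where
  "borel_of_topology X = sigma (topspace X) {U. openin X U}"

text \<open>Elements of the \<open>L\<^sup>2\<close> spaces are represented by functions, not by a.e. classes.\<close>

definition L2 :: "'s measure \<Rightarrow> ('s \<Rightarrow> real) set" where
  "L2 \<omega> = {f \<in> borel_measurable \<omega>. integrable \<omega> (\<lambda>x. (f x)\<^sup>2)}"

definition L2_0 :: "'s measure \<Rightarrow> ('s \<Rightarrow> real) set" where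
  "L2_0 \<omega> = {f \<in> L2 \<omega>. (\<integral>x. f x \<partial>\<omega>) = 0}"

definition L2_inner :: "'s measure \<Rightarrow> ('s \<Rightarrow> real) \<Rightarrow> ('s \<Rightarrow> real) \<Rightarrow> real" where
  "L2_inner \<omega> f g = (\<integral>x. f x * g x \<partial>\<omega>)"

definition L2_norm :: "'s measure \<Rightarrow> ('s \<Rightarrow> real) \<Rightarrow> real" where
  "L2_norm \<omega> f = sqrt (L2_inner \<omega> f f)"

text \<open>The underlying measurable space is given as a measure \<open>S\<close> of which only \<open>space S\<close> and
  \<open>sets S\<close> are used.\<close>

definition markov_kernel :: "'s measure \<Rightarrow> ('s \<Rightarrow> 's measure) \<Rightarrow> bool" where
  "markov_kernel S K \<longleftrightarrow> K \<in> measurable S (prob_algebra S)"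

definition reversible_kernel :: "'s measure \<Rightarrow> ('s \<Rightarrow> 's measure) \<Rightarrow> bool" where
  "reversible_kernel \<omega> K \<longleftrightarrow> (\<forall>A\<in>sets \<omega>. \<forall>B\<in>sets \<omega>.
     (\<integral>\<^sup>+x\<in>A. emeasure (K x) B \<partial>\<omega>) = (\<integral>\<^sup>+x\<in>B. emeasure (K x) A \<partial>\<omega>))"

definition kernel_op :: "('s \<Rightarrow> 's measure) \<Rightarrow> ('s \<Rightarrow> real) \<Rightarrow> 's \<Rightarrow> real" where
  "kernel_op K f = (\<lambda>y. \<integral>z. f z \<partial>K y)"

definition kernel_norm :: "'s measure \<Rightarrow> ('s \<Rightarrow> 's measure) \<Rightarrow> real" where
  "kernel_norm \<omega> K = Sup {L2_norm \<omega> (kernel_op K f) | f. f \<in> L2_0 \<omega> \<and> L2_norm \<omega> f \<le> 1}"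

definition dirichlet_form :: "'s measure \<Rightarrow> ('s \<Rightarrow> 's measure) \<Rightarrow> ('s \<Rightarrow> real) \<Rightarrow> real" where
  "dirichlet_form \<omega> K f =
     (let h = (\<lambda>x. f x - (\<integral>z. f z \<partial>\<omega>))
      in (L2_norm \<omega> h)\<^sup>2 - L2_inner \<omega> h (kernel_op K h))"

text \<open>The law of the whole trajectory \<open>(X(s))\<close>, \<open>s \<ge> 0\<close>, with \<open>X(0)\<close> distributed as \<open>\<omega>\<close> and
  transition kernel \<open>K\<close>, obtained from the Ionescu-Tulcea construction. The process is the
  coordinate process \<open>X(s) = (\<lambda>\<xi>. \<xi> s)\<close>. This is meaningful when \<open>\<omega>\<close> is a probability measure and
  \<open>markov_kernel \<omega> K\<close>.\<close>

definition chain_step :: "'s measure \<Rightarrow> ('s \<Rightarrow> 's measure) \<Rightarrow> nat \<Rightarrow> (nat \<Rightarrow> 's) \<Rightarrow> 's measure" where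
  "chain_step \<omega> K i \<xi> = (case i of 0 \<Rightarrow> \<omega> | Suc j \<Rightarrow> K (\<xi> j))"

definition chain_law :: "'s measure \<Rightarrow> ('s \<Rightarrow> 's measure) \<Rightarrow> (nat \<Rightarrow> 's) measure" where
  "chain_law \<omega> K =
     projective_family.lim UNIV (Ionescu_Tulcea.CI (chain_step \<omega> K) (\<lambda>_. \<omega>)) (\<lambda>_. \<omega>)"

definition scaled_var :: "'s measure \<Rightarrow> ('s \<Rightarrow> 's measure) \<Rightarrow> ('s \<Rightarrow> real) \<Rightarrow> nat \<Rightarrow> real" where
  "scaled_var \<omega> K f t =
     prob_space.variance (chain_law \<omega> K) (\<lambda>\<xi>. \<Sum>s=1..t. f (\<xi> s)) / real t"

definition asymp_var :: "'s measure \<Rightarrow> ('s \<Rightarrow> 's measure) \<Rightarrow> ('s \<Rightarrow> real) \<Rightarrow> real" where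
  "asymp_var \<omega> K f = lim (scaled_var \<omega> K f)"

text \<open>Points of the product are extensional functions on \<open>{1..n}\<close>, and \<open>x\<^sub>-\<^sub>i\<close> is
  \<open>drop_coord n i x\<close>.\<close>

definition drop_coord :: "nat \<Rightarrow> nat \<Rightarrow> (nat \<Rightarrow> 'a) \<Rightarrow> nat \<Rightarrow> 'a" where
  "drop_coord n i x = restrict x ({1..n} - {i})"

abbreviation prod_space :: "nat \<Rightarrow> (nat \<Rightarrow> 'a measure) \<Rightarrow> (nat \<Rightarrow> 'a) measure" where
  "prod_space n B \<equiv> PiM {1..n} B"

abbreviation prod_space_minus ::
  "nat \<Rightarrow> (nat \<Rightarrow> 'a measure) \<Rightarrow> nat \<Rightarrow> (nat \<Rightarrow> 'a) measure" where
  "prod_space_minus n B i \<equiv> PiM ({1..n} - {i}) B"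

definition marginal_minus ::
  "nat \<Rightarrow> (nat \<Rightarrow> 'a measure) \<Rightarrow> (nat \<Rightarrow> 'a) measure \<Rightarrow> nat \<Rightarrow> (nat \<Rightarrow> 'a) measure" where
  "marginal_minus n B \<pi> i = distr \<pi> (prod_space_minus n B i) (drop_coord n i)"

text \<open>\<open>\<kappa>\<close> is a regular version of the conditional distribution of \<open>X\<^sub>i\<close> given \<open>X\<^sub>-\<^sub>i\<close> under \<open>\<pi>\<close>.\<close>

definition regular_cond_distr ::
  "nat \<Rightarrow> (nat \<Rightarrow> 'a measure) \<Rightarrow> (nat \<Rightarrow> 'a) measure \<Rightarrow> nat \<Rightarrow> ((nat \<Rightarrow> 'a) \<Rightarrow> 'a measure) \<Rightarrow> bool"
where
  "regular_cond_distr n B \<pi> i \<kappa> \<longleftrightarrow>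
     \<kappa> \<in> measurable (prod_space_minus n B i) (prob_algebra (B i)) \<and>
     (\<forall>A\<in>sets (prod_space_minus n B i). \<forall>C\<in>sets (B i).
        emeasure \<pi> {x \<in> space \<pi>. drop_coord n i x \<in> A \<and> x i \<in> C} =
        (\<integral>\<^sup>+y\<in>A. emeasure (\<kappa> y) C \<partial>marginal_minus n B \<pi> i))"

text \<open>The kernel \<open>\<Sum>\<^sub>i p\<^sub>i R\<^sub>i(x, dx\<^sub>i') \<delta>(dx\<^sub>-\<^sub>i')\<close> with the point mass at \<open>x\<^sub>-\<^sub>i\<close>: the \<open>i\<close>th summand
  redraws coordinate \<open>i\<close> from \<open>R i x\<close> and keeps the others.\<close>

definition random_scan ::
  "nat \<Rightarrow> (nat \<Rightarrow> 'a measure) \<Rightarrow> (nat \<Rightarrow> real) \<Rightarrow> (nat \<Rightarrow> (nat \<Rightarrow> 'a) \<Rightarrow> 'a measure) \<Rightarrow>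
   (nat \<Rightarrow> 'a) \<Rightarrow> (nat \<Rightarrow> 'a) measure" where
  "random_scan n B p R x =
     measure_of (space (prod_space n B)) (sets (prod_space n B))
       (\<lambda>A. \<Sum>i=1..n. ennreal (p i) *
              emeasure (distr (R i x) (prod_space n B) (\<lambda>z. x(i := z))) A)"

definition gibbs_kernel ::
  "nat \<Rightarrow> (nat \<Rightarrow> 'a measure) \<Rightarrow> (nat \<Rightarrow> real) \<Rightarrow> (nat \<Rightarrow> (nat \<Rightarrow> 'a) \<Rightarrow> 'a measure) \<Rightarrow>
   (nat \<Rightarrow> 'a) \<Rightarrow> (nat \<Rightarrow> 'a) measure" where
  "gibbs_kernel n B p \<pi>c = random_scan n B p (\<lambda>i x. \<pi>c i (drop_coord n i x))"

definition hybrid_gibbs_kernel ::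
  "nat \<Rightarrow> (nat \<Rightarrow> 'a measure) \<Rightarrow> (nat \<Rightarrow> real) \<Rightarrow> (nat \<Rightarrow> (nat \<Rightarrow> 'a) \<Rightarrow> 'a \<Rightarrow> 'a measure) \<Rightarrow>
   (nat \<Rightarrow> 'a) \<Rightarrow> (nat \<Rightarrow> 'a) measure" where
  "hybrid_gibbs_kernel n B p Q = random_scan n B p (\<lambda>i x. Q i (drop_coord n i x) (x i))"

end

theory Submission
  imports Defs
begin

text \<open>
  Summing the covariances of the stationary chain gives
  \<open>var\<^sub>K(f) = 2 S\<^sub>K(f) - \<parallel>f\<parallel>\<^sup>2\<close> with \<open>S\<^sub>K(f) = \<Sum>\<^sub>s \<langle>f, K\<^sup>s f\<rangle> = \<langle>f, (I - K)\<^sup>-\<^sup>1 f\<rangle>\<close>, and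
  \<open>S\<^sub>K(f)\<close> is the supremum of \<open>2 \<langle>f, g\<rangle> - \<E>\<^sub>K(g)\<close> over \<open>g \<in> L\<^sup>2\<^sub>0\<close>. Hence \<open>\<E>\<^sub>K \<le> c \<E>\<^sub>L\<close> implies
  \<open>S\<^sub>L \<le> c S\<^sub>K\<close>. Disintegrating \<open>\<Pi>\<close> along each coordinate writes both Dirichlet forms as the same
  average of fibre energies, the exact Gibbs fibre energy being a variance, so the hypothesis gives
  \<open>c\<^sub>1 \<E>\<^sub>T \<le> \<E>\<^sub>H \<le> c\<^sub>2 \<E>\<^sub>T\<close> for the hybrid kernel \<open>H\<close>. As \<open>T\<close> is positive, \<open>0 \<le> \<E>\<^sub>T(g) \<le> \<parallel>g\<parallel>\<^sup>2\<close>; together with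
  \<open>\<parallel>T\<parallel> < 1\<close>, \<open>c\<^sub>1 > 0\<close> and \<open>c\<^sub>2 < 2\<close> this keeps the spectrum of the hybrid kernel away from \<open>\<plusminus>1\<close>.
\<close>

section \<open>Kernel products\<close>

text \<open>Comparing the inverses of \<open>I - K\<close> for two kernels through their energies
  would ordinarily call for operator monotonicity of the inverse. Here it amounts to evaluating one
  concave functional at test functions built from the other chain, so only inner products and limits
  of real sequences occur and no spectral theorem is used. Since functions stand for their a.e.
  classes, the operator of a kernel is additive only almost everywhere; identities are therefore
  stated for the bilinear form where possible.

  The additive terms of the bounds come from the \<open>- ||f||^2\<close> in the asymptotic
  variance: the quantity compared up to a factor is \<open>var + ||f||^2 = 2 S\<close>. The
  condition \<open>c2 < 2\<close> enters through \<open>E_H(g) \<le> c2 ||g||^2\<close>, which says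
  \<open><g, H g> \<ge> (1 - c2) ||g||^2\<close>, with a coefficient strictly above -1. The exact
  sampler is handled as the hybrid sampler whose fibre kernels forget their starting value, so each
  structural fact is proved once for both kernels.\<close>

lemma measure_eqI_rectangles:
  assumes M: "finite_measure M" and sets_M: "sets M = sets (A \<Otimes>\<^sub>M B)" and sets_N: "sets N = sets (A \<Otimes>\<^sub>M B)"
    and eq: "\<And>a b. a \<in> sets A \<Longrightarrow> b \<in> sets B \<Longrightarrow> emeasure M (a \<times> b) = emeasure N (a \<times> b)"
  shows "M = N"
proof (rule measure_eqI_generator_eq[where \<Omega> = "space A \<times> space B"
      and E = "{a \<times> b | a b. a \<in> sets A \<and> b \<in> sets B}" and A = "\<lambda>_. space A \<times> space B"])
  show "Int_stable {a \<times> b | a b. a \<in> sets A \<and> b \<in> sets B}"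
    by (rule Int_stable_pair_measure_generator)
  show "{a \<times> b | a b. a \<in> sets A \<and> b \<in> sets B} \<subseteq> Pow (space A \<times> space B)"
    by (rule pair_measure_closed)
  show "emeasure M (space A \<times> space B) \<noteq> \<infinity>" for i :: nat
    using M by (simp add: finite_measure.emeasure_finite)
qed (use assms in \<open>auto simp: sets_pair_measure\<close>)

text \<open>The law \<open>M(dx) K(x, dy)\<close>. It appears in three roles: two successive states
  of a chain, the split of \<open>\<pi>\<close> into one coordinate and the remaining ones, and a
  pair of states extended by one more step.\<close>

definition kernel_prod :: "'s measure \<Rightarrow> 't measure \<Rightarrow> ('s \<Rightarrow> 't measure) \<Rightarrow> ('s \<times> 't) measure" where
  "kernel_prod M N K = M \<bind> (\<lambda>x. distr (K x) (M \<Otimes>\<^sub>M N) (Pair x))"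

locale prob_kernel = prob_space M for M :: "'s measure" +
  fixes N :: "'t measure" and K :: "'s \<Rightarrow> 't measure"
  assumes kernel[measurable]: "K \<in> measurable M (prob_algebra N)"
begin

lemma kernel_sub[measurable]: "K \<in> measurable M (subprob_algebra N)"
  by (rule measurable_prob_algebraD) (rule kernel)

lemma sets_kernel_eq: "x \<in> space M \<Longrightarrow> sets (K x) = sets N"
  using measurable_space[OF kernel] by (simp add: space_prob_algebra)

lemma space_kernel_eq: "x \<in> space M \<Longrightarrow> space (K x) = space N"
  by (rule sets_eq_imp_space_eq) (rule sets_kernel_eq)

lemma prob_kernel: "x \<in> space M \<Longrightarrow> prob_space (K x)"
  using measurable_space[OF kernel] by (simp add: space_prob_algebra)

lemma kernel_pair[measurable]:
  "(\<lambda>x. distr (K x) (M \<Otimes>\<^sub>M N) (Pair x)) \<in> measurable M (prob_algebra (M \<Otimes>\<^sub>M N))"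
  by measurable

lemma kernel_prod_in: "kernel_prod M N K \<in> space (prob_algebra (M \<Otimes>\<^sub>M N))"
  unfolding kernel_prod_def
  using measurable_bind_prob_space[OF measurable_const[of M "prob_algebra M"] kernel_pair, of "count_space {()}"]
  by (auto dest!: measurable_space simp: space_prob_algebra prob_space_axioms)

lemma sets_kernel_prod[simp, measurable_cong]: "sets (kernel_prod M N K) = sets (M \<Otimes>\<^sub>M N)"
  using kernel_prod_in by (simp add: space_prob_algebra)

lemma space_kernel_prod[simp]: "space (kernel_prod M N K) = space M \<times> space N"
  using sets_eq_imp_space_eq[OF sets_kernel_prod] by (simp add: space_pair_measure)

lemma prob_space_kernel_prod: "prob_space (kernel_prod M N K)"
  using kernel_prod_in by (simp add: space_prob_algebra)

lemma measurable_section: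
  "F \<in> measurable (M \<Otimes>\<^sub>M N) L \<Longrightarrow> x \<in> space M \<Longrightarrow> (\<lambda>y. F (x, y)) \<in> measurable (K x) L"
  by (simp add: sets_kernel_eq cong: measurable_cong_sets)

lemma Pair_measurable_kernel: "x \<in> space M \<Longrightarrow> Pair x \<in> measurable (K x) (M \<Otimes>\<^sub>M N)"
  by (simp add: sets_kernel_eq cong: measurable_cong_sets)

lemma nn_integral_kernel_prod:
  assumes F[measurable]: "F \<in> borel_measurable (M \<Otimes>\<^sub>M N)"
  shows "(\<integral>\<^sup>+w. F w \<partial>kernel_prod M N K) = (\<integral>\<^sup>+x. \<integral>\<^sup>+y. F (x, y) \<partial>K x \<partial>M)"
proof -
  have "(\<integral>\<^sup>+w. F w \<partial>kernel_prod M N K) =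
      (\<integral>\<^sup>+x. \<integral>\<^sup>+w. F w \<partial>distr (K x) (M \<Otimes>\<^sub>M N) (Pair x) \<partial>M)"
    unfolding kernel_prod_def
    by (rule nn_integral_bind[where B = "M \<Otimes>\<^sub>M N"]) (auto intro: measurable_prob_algebraD)
  also have "\<dots> = (\<integral>\<^sup>+x. \<integral>\<^sup>+y. F (x, y) \<partial>K x \<partial>M)"
    by (intro nn_integral_cong nn_integral_distr Pair_measurable_kernel) simp_all
  finally show ?thesis .
qed

lemma nn_integral_kernel_measurable[measurable]:
  assumes F: "F \<in> borel_measurable (M \<Otimes>\<^sub>M N)"
  shows "(\<lambda>x. \<integral>\<^sup>+y. F (x, y) \<partial>K x) \<in> borel_measurable M"
  by (rule nn_integral_measurable_subprob_algebra2[OF _ kernel_sub]) (simp add: F)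

text \<open>The dependence of the integrand on \<open>x\<close> is moved into the measure by pushing
  \<open>K x\<close> forward under \<open>Pair x\<close>; then one fixed \<open>F\<close> is
  integrated against a measure that varies measurably.\<close>

lemma integral_kernel_measurable[measurable]:
  fixes F :: "'s \<times> 't \<Rightarrow> real"
  assumes F[measurable]: "F \<in> borel_measurable (M \<Otimes>\<^sub>M N)"
  shows "(\<lambda>x. \<integral>y. F (x, y) \<partial>K x) \<in> borel_measurable M"
proof (rule measurable_cong[THEN iffD1])
  show "(\<integral>w. F w \<partial>distr (K x) (M \<Otimes>\<^sub>M N) (Pair x)) = (\<integral>y. F (x, y) \<partial>K x)" if "x \<in> space M" for x
    by (rule integral_distr[OF Pair_measurable_kernel[OF that] F])
  show "(\<lambda>x. \<integral>w. F w \<partial>distr (K x) (M \<Otimes>\<^sub>M N) (Pair x)) \<in> borel_measurable M"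
    by (rule measurable_compose[OF measurable_prob_algebraD[OF kernel_pair] integral_measurable_subprob_algebra]) (rule F)
qed

text \<open>Finiteness of the iterated \<open>nn_integral\<close> makes almost every section
  integrable. On the remaining null set the Bochner integral takes its default value 0, so the two
  kinds of inner integral agree only almost everywhere.\<close>

lemma kernel_prod_nonneg:
  fixes F :: "'s \<times> 't \<Rightarrow> real"
  assumes F: "integrable (kernel_prod M N K) F" and nonneg: "\<And>w. 0 \<le> F w"
  shows "AE x in M. integrable (K x) (\<lambda>y. F (x, y))"
    and "integrable M (\<lambda>x. \<integral>y. F (x, y) \<partial>K x)"
    and "(\<integral>w. F w \<partial>kernel_prod M N K) = (\<integral>x. \<integral>y. F (x, y) \<partial>K x \<partial>M)"
proof -
  have Fm[measurable]: "F \<in> borel_measurable (M \<Otimes>\<^sub>M N)"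
    using borel_measurable_integrable[OF F] by (simp cong: measurable_cong_sets)
  have eq: "(\<integral>\<^sup>+x. \<integral>\<^sup>+y. ennreal (F (x, y)) \<partial>K x \<partial>M) = ennreal (\<integral>w. F w \<partial>kernel_prod M N K)"
    using nn_integral_eq_integral[OF F] nonneg by (simp add: nn_integral_kernel_prod)
  have "AE x in M. (\<integral>\<^sup>+y. ennreal (F (x, y)) \<partial>K x) \<noteq> \<infinity>"
    by (rule nn_integral_PInf_AE) (auto simp: eq)
  with AE_space show int: "AE x in M. integrable (K x) (\<lambda>y. F (x, y))"
  proof eventually_elim
    case (elim x)
    then show ?case
      using nonneg by (intro integrableI_nonneg measurable_section Fm) (auto simp: top.not_eq_extremum)
  qed
  from int have "AE x in M. (\<integral>\<^sup>+y. ennreal (F (x, y)) \<partial>K x) = ennreal (\<integral>y. F (x, y) \<partial>K x)"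
    by eventually_elim (simp add: nn_integral_eq_integral nonneg)
  then have "(\<integral>\<^sup>+x. ennreal (\<integral>y. F (x, y) \<partial>K x) \<partial>M) = ennreal (\<integral>w. F w \<partial>kernel_prod M N K)"
    unfolding eq[symmetric] by (intro nn_integral_cong_AE) auto
  then have "has_bochner_integral M (\<lambda>x. \<integral>y. F (x, y) \<partial>K x) (\<integral>w. F w \<partial>kernel_prod M N K)"
    using nonneg by (intro has_bochner_integral_nn_integral) auto
  then show "integrable M (\<lambda>x. \<integral>y. F (x, y) \<partial>K x)"
    and "(\<integral>w. F w \<partial>kernel_prod M N K) = (\<integral>x. \<integral>y. F (x, y) \<partial>K x \<partial>M)"
    by (auto simp: has_bochner_integral_iff)
qed

lemma
  fixes F :: "'s \<times> 't \<Rightarrow> real"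
  assumes F: "integrable (kernel_prod M N K) F"
  shows AE_integrable_kernel: "AE x in M. integrable (K x) (\<lambda>y. F (x, y))"
    and integrable_kernel_prod: "integrable M (\<lambda>x. \<integral>y. F (x, y) \<partial>K x)"
    and integral_kernel_prod: "(\<integral>w. F w \<partial>kernel_prod M N K) = (\<integral>x. \<integral>y. F (x, y) \<partial>K x \<partial>M)"
proof -
  define P where "P w = max 0 (F w)" for w
  define Q where "Q w = max 0 (- F w)" for w
  have FPQ: "F = (\<lambda>w. P w - Q w)"
    by (auto simp: P_def Q_def fun_eq_iff)
  have P: "integrable (kernel_prod M N K) P" and Q: "integrable (kernel_prod M N K) Q"
    using F unfolding P_def[abs_def] Q_def[abs_def] by auto
  have nonneg: "0 \<le> P w" "0 \<le> Q w" for w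
    by (auto simp: P_def Q_def)
  note p = kernel_prod_nonneg[OF P nonneg(1)] and q = kernel_prod_nonneg[OF Q nonneg(2)]
  have Fm[measurable]: "F \<in> borel_measurable (M \<Otimes>\<^sub>M N)"
    using borel_measurable_integrable[OF F] by (simp cong: measurable_cong_sets)
  from p(1) q(1) show int: "AE x in M. integrable (K x) (\<lambda>y. F (x, y))"
    by eventually_elim (simp add: FPQ)
  from p(1) q(1) have ae: "AE x in M. (\<integral>y. F (x, y) \<partial>K x) = (\<integral>y. P (x, y) \<partial>K x) - (\<integral>y. Q (x, y) \<partial>K x)"
    by eventually_elim (simp add: FPQ)
  have Pm[measurable]: "P \<in> borel_measurable (M \<Otimes>\<^sub>M N)" "Q \<in> borel_measurable (M \<Otimes>\<^sub>M N)"
    by (simp_all add: P_def[abs_def] Q_def[abs_def])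
  have "integrable M (\<lambda>x. (\<integral>y. P (x, y) \<partial>K x) - (\<integral>y. Q (x, y) \<partial>K x))"
    using p q by simp
  then show "integrable M (\<lambda>x. \<integral>y. F (x, y) \<partial>K x)"
    using ae by (subst integrable_cong_AE) auto
  have "(\<integral>x. \<integral>y. F (x, y) \<partial>K x \<partial>M) = (\<integral>x. (\<integral>y. P (x, y) \<partial>K x) - (\<integral>y. Q (x, y) \<partial>K x) \<partial>M)"
    using ae by (intro integral_cong_AE) auto
  also have "\<dots> = (\<integral>w. P w \<partial>kernel_prod M N K) - (\<integral>w. Q w \<partial>kernel_prod M N K)"
    using p q by simp
  also have "\<dots> = (\<integral>w. F w \<partial>kernel_prod M N K)"
    using P Q by (simp add: FPQ)
  finally show "(\<integral>w. F w \<partial>kernel_prod M N K) = (\<integral>x. \<integral>y. F (x, y) \<partial>K x \<partial>M)" ..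
qed

lemma emeasure_kernel_prod_Times:
  assumes [measurable]: "A \<in> sets M" "B \<in> sets N"
  shows "emeasure (kernel_prod M N K) (A \<times> B) = (\<integral>\<^sup>+x\<in>A. emeasure (K x) B \<partial>M)"
proof -
  have "emeasure (kernel_prod M N K) (A \<times> B) = (\<integral>\<^sup>+w. indicator (A \<times> B) w \<partial>kernel_prod M N K)"
    by simp
  also have "\<dots> = (\<integral>\<^sup>+x. \<integral>\<^sup>+y. indicator A x * indicator B y \<partial>K x \<partial>M)"
    by (subst nn_integral_kernel_prod) (auto simp: indicator_times)
  also have "\<dots> = (\<integral>\<^sup>+x\<in>A. emeasure (K x) B \<partial>M)"
    by (intro nn_integral_cong)
       (auto simp: nn_integral_cmult sets_kernel_eq mult.commute)
  finally show ?thesis .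
qed

end

section \<open>Reversible kernels on \<open>L\<^sup>2\<close>\<close>

lemma L2_measurable[measurable_dest]: "u \<in> L2 \<omega> \<Longrightarrow> u \<in> borel_measurable \<omega>"
  by (simp add: L2_def)

lemma L2_integrable_square: "u \<in> L2 \<omega> \<Longrightarrow> integrable \<omega> (\<lambda>x. (u x)\<^sup>2)"
  by (simp add: L2_def)

text \<open>The sharp factor 1/2 is given away: the bound only serves to dominate products by
  integrable functions.\<close>

lemma abs_mult_le_squares: "\<bar>a * b\<bar> \<le> a\<^sup>2 + (b::real)\<^sup>2"
proof -
  have "2 * (\<bar>a\<bar> * \<bar>b\<bar>) \<le> \<bar>a\<bar>\<^sup>2 + \<bar>b\<bar>\<^sup>2"
    using sum_squares_bound[of "\<bar>a\<bar>" "\<bar>b\<bar>"] by simp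
  moreover have "0 \<le> \<bar>a\<bar> * \<bar>b\<bar>"
    by simp
  ultimately show ?thesis
    unfolding abs_mult power2_abs by linarith
qed

lemma L2_integrable_mult:
  assumes u: "u \<in> L2 \<omega>" and v: "v \<in> L2 \<omega>"
  shows "integrable \<omega> (\<lambda>x. u x * v x)"
proof (rule Bochner_Integration.integrable_bound)
  show "integrable \<omega> (\<lambda>x. (u x)\<^sup>2 + (v x)\<^sup>2)"
    using u v by (simp add: L2_def)
  show "(\<lambda>x. u x * v x) \<in> borel_measurable \<omega>"
    using u v by measurable
  show "AE x in \<omega>. norm (u x * v x) \<le> norm ((u x)\<^sup>2 + (v x)\<^sup>2)"
    using abs_mult_le_squares by (auto simp del: abs_mult)
qed

lemma L2_scale: "u \<in> L2 \<omega> \<Longrightarrow> (\<lambda>x. c * u x) \<in> L2 \<omega>"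
  by (auto simp: L2_def power_mult_distrib)

lemma L2_add: assumes "u \<in> L2 \<omega>" "v \<in> L2 \<omega>" shows "(\<lambda>x. u x + v x) \<in> L2 \<omega>"
  using assms L2_integrable_mult[OF assms] by (auto simp: L2_def power2_sum mult.assoc)

lemma L2_diff: assumes "u \<in> L2 \<omega>" "v \<in> L2 \<omega>" shows "(\<lambda>x. u x - v x) \<in> L2 \<omega>"
  using L2_add[OF assms(1) L2_scale[OF assms(2), of "-1"]] by simp

lemma L2_zero: "(\<lambda>x. 0) \<in> L2 \<omega>"
  by (simp add: L2_def)

lemma L2_sum: "(\<And>s. s \<in> A \<Longrightarrow> u s \<in> L2 \<omega>) \<Longrightarrow> (\<lambda>x. \<Sum>s\<in>A. u s x) \<in> L2 \<omega>"
  by (induction A rule: infinite_finite_induct) (auto intro: L2_zero L2_add)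

lemma L2_inner_commute: "L2_inner \<omega> u v = L2_inner \<omega> v u"
  by (simp add: L2_inner_def mult.commute)

lemma L2_inner_scale_left: "L2_inner \<omega> (\<lambda>x. c * u x) v = c * L2_inner \<omega> u v"
  by (simp add: L2_inner_def mult.assoc)

lemma L2_inner_scale_right: "L2_inner \<omega> u (\<lambda>x. c * v x) = c * L2_inner \<omega> u v"
  by (simp add: L2_inner_commute[of \<omega> u] L2_inner_scale_left)

lemma L2_inner_add_left:
  "u \<in> L2 \<omega> \<Longrightarrow> v \<in> L2 \<omega> \<Longrightarrow> w \<in> L2 \<omega> \<Longrightarrow>
    L2_inner \<omega> (\<lambda>x. u x + v x) w = L2_inner \<omega> u w + L2_inner \<omega> v w"
  by (simp add: L2_inner_def distrib_right L2_integrable_mult)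

lemma L2_inner_add_right:
  "u \<in> L2 \<omega> \<Longrightarrow> v \<in> L2 \<omega> \<Longrightarrow> w \<in> L2 \<omega> \<Longrightarrow>
    L2_inner \<omega> w (\<lambda>x. u x + v x) = L2_inner \<omega> w u + L2_inner \<omega> w v"
  by (simp add: L2_inner_def distrib_left L2_integrable_mult)

lemma L2_inner_diff_left:
  "u \<in> L2 \<omega> \<Longrightarrow> v \<in> L2 \<omega> \<Longrightarrow> w \<in> L2 \<omega> \<Longrightarrow>
    L2_inner \<omega> (\<lambda>x. u x - v x) w = L2_inner \<omega> u w - L2_inner \<omega> v w"
  by (simp add: L2_inner_def left_diff_distrib L2_integrable_mult)

lemma L2_inner_diff_right:
  "u \<in> L2 \<omega> \<Longrightarrow> v \<in> L2 \<omega> \<Longrightarrow> w \<in> L2 \<omega> \<Longrightarrow>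
    L2_inner \<omega> w (\<lambda>x. u x - v x) = L2_inner \<omega> w u - L2_inner \<omega> w v"
  by (simp add: L2_inner_def right_diff_distrib L2_integrable_mult)

lemma L2_inner_sum_right:
  assumes "\<And>s. s \<in> A \<Longrightarrow> u s \<in> L2 \<omega>" "w \<in> L2 \<omega>"
  shows "L2_inner \<omega> w (\<lambda>x. \<Sum>s\<in>A. u s x) = (\<Sum>s\<in>A. L2_inner \<omega> w (u s))"
  using assms by (simp add: L2_inner_def sum_distrib_left L2_integrable_mult)

lemma L2_inner_nonneg: "0 \<le> L2_inner \<omega> u u"
  by (simp add: L2_inner_def)

lemma L2_norm_square: "(L2_norm \<omega> u)\<^sup>2 = L2_inner \<omega> u u"
  by (simp add: L2_norm_def L2_inner_nonneg)

text \<open>Expanding the squared norms of \<open>r u + v\<close> and \<open>r u - v\<close> gives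
  Young's inequality. The free weight does the work of Cauchy-Schwarz later, chosen as 1, as an
  operator bound, or as a decay factor \<open>r ^ s\<close>.\<close>

lemma L2_inner_le_scaled:
  assumes "u \<in> L2 \<omega>" "v \<in> L2 \<omega>" "0 < r"
  shows "2 * \<bar>L2_inner \<omega> u v\<bar> \<le> r * L2_inner \<omega> u u + L2_inner \<omega> v v / r"
proof -
  have "0 \<le> L2_inner \<omega> (\<lambda>x. r * u x + v x) (\<lambda>x. r * u x + v x)"
    "0 \<le> L2_inner \<omega> (\<lambda>x. r * u x - v x) (\<lambda>x. r * u x - v x)"
    by (rule L2_inner_nonneg)+
  then have "0 \<le> r * r * L2_inner \<omega> u u + 2 * r * L2_inner \<omega> u v + L2_inner \<omega> v v"
    "0 \<le> r * r * L2_inner \<omega> u u - 2 * r * L2_inner \<omega> u v + L2_inner \<omega> v v"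
    using assms
    by (simp_all add: L2_inner_add_left L2_inner_add_right L2_inner_diff_left L2_inner_diff_right
        L2_inner_scale_left L2_inner_scale_right L2_add L2_diff L2_scale L2_inner_commute[of \<omega> v u] algebra_simps)
  then have "2 * r * \<bar>L2_inner \<omega> u v\<bar> \<le> r * r * L2_inner \<omega> u u + L2_inner \<omega> v v"
    using assms by (auto simp: abs_if)
  then have "2 * r * \<bar>L2_inner \<omega> u v\<bar> / r \<le> (r * r * L2_inner \<omega> u u + L2_inner \<omega> v v) / r"
    using assms by (intro divide_right_mono) auto
  then show ?thesis
    using assms by (simp add: add_divide_distrib)
qed

lemma L2_0_imp_L2: "u \<in> L2_0 \<omega> \<Longrightarrow> u \<in> L2 \<omega>"
  by (simp add: L2_0_def)

lemma L2_0_scale: "u \<in> L2_0 \<omega> \<Longrightarrow> (\<lambda>x. c * u x) \<in> L2_0 \<omega>"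
  by (simp add: L2_0_def L2_scale)

context prob_space
begin

lemma L2_integrable: "u \<in> L2 M \<Longrightarrow> integrable M u"
  unfolding L2_def by (auto intro: square_integrable_imp_integrable)

lemma L2_const: "(\<lambda>x. c) \<in> L2 M"
  by (simp add: L2_def)

lemma L2_0_add: "u \<in> L2_0 M \<Longrightarrow> v \<in> L2_0 M \<Longrightarrow> (\<lambda>x. u x + v x) \<in> L2_0 M"
  by (simp add: L2_0_def L2_add L2_integrable)

lemma L2_0_diff: "u \<in> L2_0 M \<Longrightarrow> v \<in> L2_0 M \<Longrightarrow> (\<lambda>x. u x - v x) \<in> L2_0 M"
  by (simp add: L2_0_def L2_diff L2_integrable)

lemma L2_0_sum: "(\<And>s. s \<in> A \<Longrightarrow> u s \<in> L2_0 M) \<Longrightarrow> (\<lambda>x. \<Sum>s\<in>A. u s x) \<in> L2_0 M"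
  by (auto simp: L2_0_def L2_sum L2_integrable)

lemma L2_0_center: "u \<in> L2 M \<Longrightarrow> (\<lambda>x. u x - (\<integral>z. u z \<partial>M)) \<in> L2_0 M"
  by (simp add: L2_0_def L2_diff L2_const L2_integrable prob_space)

lemma square_integral_le:
  assumes "u \<in> L2 M"
  shows "(\<integral>x. u x \<partial>M)\<^sup>2 \<le> (\<integral>x. (u x)\<^sup>2 \<partial>M)"
  using variance_positive[of u] variance_eq[of u] assms
  by (simp add: L2_integrable L2_integrable_square)

end

section \<open>The joint law of two successive states and self-adjointness\<close>

locale reversible_chain = prob_space \<omega> for \<omega> :: "'s measure" +
  fixes K :: "'s \<Rightarrow> 's measure"
  assumes markov: "markov_kernel \<omega> K" and reversible: "reversible_kernel \<omega> K"

sublocale reversible_chain \<subseteq> prob_kernel \<omega> \<omega> K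
  using markov by unfold_locales (simp add: markov_kernel_def)

context reversible_chain
begin

abbreviation joint :: "('s \<times> 's) measure" where "joint \<equiv> kernel_prod \<omega> \<omega> K"

lemma swap_measurable_joint: "prod.swap \<in> measurable joint (\<omega> \<Otimes>\<^sub>M \<omega>)"
  by (rule measurable_cong_sets[OF sets_kernel_prod refl, THEN equalityD2, THEN subsetD])
     (simp add: prod.swap_def[abs_def])

text \<open>Reversibility is the symmetry of the joint law on rectangles, and rectangles determine a
  finite measure. Invariance of \<open>\<omega>\<close> and self-adjointness of the operator thereby
  become changes of variables.\<close>

lemma distr_joint_swap: "distr joint (\<omega> \<Otimes>\<^sub>M \<omega>) prod.swap = joint"
proof (rule measure_eqI_rectangles[of _ \<omega> \<omega>])
  interpret J: prob_space joint by (rule prob_space_kernel_prod)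
  note m = swap_measurable_joint
  show "finite_measure (distr joint (\<omega> \<Otimes>\<^sub>M \<omega>) prod.swap)"
    using m by (rule J.finite_measure_distr)
  fix a b assume ab: "a \<in> sets \<omega>" "b \<in> sets \<omega>"
  have "emeasure (distr joint (\<omega> \<Otimes>\<^sub>M \<omega>) prod.swap) (a \<times> b) = emeasure joint (prod.swap -` (a \<times> b) \<inter> space joint)"
    using ab m by (intro emeasure_distr) auto
  also have "prod.swap -` (a \<times> b) \<inter> space joint = b \<times> a"
    using ab sets.sets_into_space by force
  also have "emeasure joint (b \<times> a) = emeasure joint (a \<times> b)"
    using ab reversible by (simp add: emeasure_kernel_prod_Times reversible_kernel_def)
  finally show "emeasure (distr joint (\<omega> \<Otimes>\<^sub>M \<omega>) prod.swap) (a \<times> b) = emeasure joint (a \<times> b)" .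
qed auto

lemma
  fixes F :: "'s \<times> 's \<Rightarrow> real"
  assumes F: "F \<in> borel_measurable (\<omega> \<Otimes>\<^sub>M \<omega>)"
  shows integral_joint_swap: "(\<integral>w. F (prod.swap w) \<partial>joint) = (\<integral>w. F w \<partial>joint)"
    and integrable_joint_swap: "integrable joint (\<lambda>w. F (prod.swap w)) \<longleftrightarrow> integrable joint F"
  using integral_distr[OF swap_measurable_joint F] integrable_distr_eq[OF swap_measurable_joint F]
  by (simp_all add: distr_joint_swap)

lemma nn_integral_joint_swap:
  "F \<in> borel_measurable (\<omega> \<Otimes>\<^sub>M \<omega>) \<Longrightarrow> (\<integral>\<^sup>+w. F (prod.swap w) \<partial>joint) = (\<integral>\<^sup>+w. F w \<partial>joint)"
  using nn_integral_distr[OF swap_measurable_joint, of F] by (simp add: distr_joint_swap)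

lemma nn_integral_fst_joint:
  assumes u[measurable]: "u \<in> borel_measurable \<omega>"
  shows "(\<integral>\<^sup>+w. u (fst w) \<partial>joint) = (\<integral>\<^sup>+x. u x \<partial>\<omega>)"
proof -
  have "(\<integral>\<^sup>+w. u (fst w) \<partial>joint) = (\<integral>\<^sup>+x. \<integral>\<^sup>+y. u x \<partial>K x \<partial>\<omega>)"
    by (subst nn_integral_kernel_prod) auto
  also have "\<dots> = (\<integral>\<^sup>+x. u x \<partial>\<omega>)"
    by (intro nn_integral_cong) (simp add: prob_space.emeasure_space_1[OF prob_kernel])
  finally show ?thesis .
qed

lemma distr_fst_joint: "distr joint \<omega> fst = \<omega>"
proof (rule measure_eqI)
  fix A assume "A \<in> sets (distr joint \<omega> fst)"
  then have [measurable]: "A \<in> sets \<omega>" by simp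
  have "emeasure (distr joint \<omega> fst) A = (\<integral>\<^sup>+w. indicator A (fst w) \<partial>joint)"
    by (subst nn_integral_indicator[symmetric], simp, subst nn_integral_distr)
       (simp_all cong: measurable_cong_sets)
  then show "emeasure (distr joint \<omega> fst) A = emeasure \<omega> A"
    by (simp add: nn_integral_fst_joint)
qed simp

text \<open>Symmetry makes the second marginal of the joint law equal to the first, which is
  \<open>\<omega>\<close>.\<close>

lemma nn_integral_invariant:
  assumes u[measurable]: "u \<in> borel_measurable \<omega>"
  shows "(\<integral>\<^sup>+x. \<integral>\<^sup>+y. u y \<partial>K x \<partial>\<omega>) = (\<integral>\<^sup>+x. u x \<partial>\<omega>)"
proof -
  have "(\<integral>\<^sup>+x. \<integral>\<^sup>+y. u y \<partial>K x \<partial>\<omega>) = (\<integral>\<^sup>+w. u (snd w) \<partial>joint)"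
    by (subst nn_integral_kernel_prod) auto
  also have "\<dots> = (\<integral>\<^sup>+w. u (fst w) \<partial>joint)"
    using nn_integral_joint_swap[of "\<lambda>w. u (fst w)"] by simp
  finally show ?thesis by (simp add: nn_integral_fst_joint)
qed

lemma
  fixes u :: "'s \<Rightarrow> real"
  assumes u[measurable]: "u \<in> borel_measurable \<omega>"
  shows integral_fst_joint: "(\<integral>w. u (fst w) \<partial>joint) = (\<integral>x. u x \<partial>\<omega>)"
    and integrable_fst_joint: "integrable joint (\<lambda>w. u (fst w)) \<longleftrightarrow> integrable \<omega> u"
proof -
  have m: "fst \<in> measurable joint \<omega>"
    by (simp cong: measurable_cong_sets)
  show "(\<integral>w. u (fst w) \<partial>joint) = (\<integral>x. u x \<partial>\<omega>)"
    using integral_distr[OF m u] by (simp add: distr_fst_joint)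
  show "integrable joint (\<lambda>w. u (fst w)) \<longleftrightarrow> integrable \<omega> u"
    using integrable_distr_eq[OF m u] by (simp add: distr_fst_joint)
qed

lemma
  fixes u :: "'s \<Rightarrow> real"
  assumes u[measurable]: "u \<in> borel_measurable \<omega>"
  shows integral_snd_joint: "(\<integral>w. u (snd w) \<partial>joint) = (\<integral>x. u x \<partial>\<omega>)"
    and integrable_snd_joint: "integrable joint (\<lambda>w. u (snd w)) \<longleftrightarrow> integrable \<omega> u"
  using integral_joint_swap[of "\<lambda>w. u (fst w)"] integrable_joint_swap[of "\<lambda>w. u (fst w)"]
  by (simp_all add: integral_fst_joint integrable_fst_joint)

lemma integrable_joint_mult:
  assumes u: "u \<in> L2 \<omega>" and v: "v \<in> L2 \<omega>"
  shows "integrable joint (\<lambda>w. u (fst w) * v (snd w))"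
proof (rule Bochner_Integration.integrable_bound)
  note [measurable] = L2_measurable[OF u] L2_measurable[OF v]
  have "integrable joint (\<lambda>w. (u (fst w))\<^sup>2)"
    by (subst integrable_fst_joint) (auto simp: L2_integrable_square u)
  moreover have "integrable joint (\<lambda>w. (v (snd w))\<^sup>2)"
    by (subst integrable_snd_joint) (auto simp: L2_integrable_square v)
  ultimately show "integrable joint (\<lambda>w. (u (fst w))\<^sup>2 + (v (snd w))\<^sup>2)"
    by simp
  show "(\<lambda>w. u (fst w) * v (snd w)) \<in> borel_measurable joint"
    by (simp cong: measurable_cong_sets)
  show "AE w in joint. norm (u (fst w) * v (snd w)) \<le> norm ((u (fst w))\<^sup>2 + (v (snd w))\<^sup>2)"
    using abs_mult_le_squares by (auto simp del: abs_mult)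
qed

lemma L2_inner_kernel_op:
  assumes u: "u \<in> L2 \<omega>" and v: "v \<in> L2 \<omega>"
  shows "L2_inner \<omega> u (kernel_op K v) = (\<integral>w. u (fst w) * v (snd w) \<partial>joint)"
  using integral_kernel_prod[OF integrable_joint_mult[OF u v]]
  by (simp add: L2_inner_def kernel_op_def)

lemma L2_inner_kernel_op_symmetric:
  assumes u: "u \<in> L2 \<omega>" and v: "v \<in> L2 \<omega>"
  shows "L2_inner \<omega> u (kernel_op K v) = L2_inner \<omega> (kernel_op K u) v"
proof -
  note [measurable] = L2_measurable[OF u] L2_measurable[OF v]
  have "(\<integral>w. u (fst w) * v (snd w) \<partial>joint) = (\<integral>w. v (fst w) * u (snd w) \<partial>joint)"
    using integral_joint_swap[of "\<lambda>w. u (fst w) * v (snd w)"] by (simp add: mult.commute)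
  then show ?thesis
    by (simp add: L2_inner_kernel_op u v L2_inner_commute[of \<omega> "kernel_op K u"])
qed

lemma kernel_op_measurable[measurable]:
  assumes [measurable]: "u \<in> borel_measurable \<omega>"
  shows "kernel_op K u \<in> borel_measurable \<omega>"
  using integral_kernel_measurable[of "\<lambda>w. u (snd w)"] by (simp add: kernel_op_def[abs_def])

text \<open>At exceptional starting points \<open>u\<close> may fail to be integrable under
  \<open>K x\<close>, and \<open>kernel_op K u x\<close> is then a default value. Invariance
  confines these points to a null set.\<close>

lemma AE_L2_kernel:
  assumes u: "u \<in> L2 \<omega>"
  shows "AE x in \<omega>. u \<in> L2 (K x)"
proof -
  note [measurable] = L2_measurable[OF u]
  have "integrable joint (\<lambda>w. (u (snd w))\<^sup>2)"
    by (subst integrable_snd_joint) (auto simp: L2_integrable_square u)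
  from AE_integrable_kernel[OF this] AE_space show ?thesis
    by eventually_elim (auto simp: L2_def sets_kernel_eq cong: measurable_cong_sets)
qed

text \<open>Jensen's inequality under each law \<open>K x\<close> bounds the squared mean by the
  mean square, and invariance evaluates the integral of the latter.\<close>

lemma
  assumes u: "u \<in> L2 \<omega>"
  shows kernel_op_L2: "kernel_op K u \<in> L2 \<omega>"
    and kernel_op_contraction: "L2_inner \<omega> (kernel_op K u) (kernel_op K u) \<le> L2_inner \<omega> u u"
proof -
  note [measurable] = L2_measurable[OF u]
  have int: "integrable joint (\<lambda>w. (u (snd w))\<^sup>2)"
    by (subst integrable_snd_joint) (auto simp: L2_integrable_square u)
  have ae: "AE x in \<omega>. (kernel_op K u x)\<^sup>2 \<le> (\<integral>y. (u y)\<^sup>2 \<partial>K x)"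
    using AE_L2_kernel[OF u] AE_space
    by eventually_elim (simp add: kernel_op_def prob_space.square_integral_le prob_kernel)
  have int': "integrable \<omega> (\<lambda>x. \<integral>y. (u y)\<^sup>2 \<partial>K x)"
    using integrable_kernel_prod[OF int] by simp
  have sq: "integrable \<omega> (\<lambda>x. (kernel_op K u x)\<^sup>2)"
    by (rule Bochner_Integration.integrable_bound[OF int']) (use ae in auto)
  then show "kernel_op K u \<in> L2 \<omega>"
    by (simp add: L2_def)
  have "(\<integral>x. (kernel_op K u x)\<^sup>2 \<partial>\<omega>) \<le> (\<integral>x. \<integral>y. (u y)\<^sup>2 \<partial>K x \<partial>\<omega>)"
    by (rule integral_mono_AE[OF sq int' ae])
  also have "\<dots> = (\<integral>w. (u (snd w))\<^sup>2 \<partial>joint)"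
    using integral_kernel_prod[OF int] by simp
  also have "\<dots> = (\<integral>x. (u x)\<^sup>2 \<partial>\<omega>)"
    by (rule integral_snd_joint) simp
  finally show "L2_inner \<omega> (kernel_op K u) (kernel_op K u) \<le> L2_inner \<omega> u u"
    by (simp add: L2_inner_def power2_eq_square)
qed

lemma integral_kernel_op:
  assumes u: "u \<in> L2 \<omega>"
  shows "(\<integral>x. kernel_op K u x \<partial>\<omega>) = (\<integral>x. u x \<partial>\<omega>)"
  using L2_inner_kernel_op[OF L2_const[of 1] u] integral_snd_joint[OF L2_measurable[OF u]]
  by (simp add: L2_inner_def)

lemma kernel_op_L2_0: "u \<in> L2_0 \<omega> \<Longrightarrow> kernel_op K u \<in> L2_0 \<omega>"
  by (simp add: L2_0_def kernel_op_L2 integral_kernel_op)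

lemma form_add_left:
  "u \<in> L2 \<omega> \<Longrightarrow> v \<in> L2 \<omega> \<Longrightarrow> w \<in> L2 \<omega> \<Longrightarrow>
    L2_inner \<omega> (\<lambda>x. u x + v x) (kernel_op K w) = L2_inner \<omega> u (kernel_op K w) + L2_inner \<omega> v (kernel_op K w)"
  by (simp add: L2_inner_add_left kernel_op_L2)

lemma form_diff_left:
  "u \<in> L2 \<omega> \<Longrightarrow> v \<in> L2 \<omega> \<Longrightarrow> w \<in> L2 \<omega> \<Longrightarrow>
    L2_inner \<omega> (\<lambda>x. u x - v x) (kernel_op K w) = L2_inner \<omega> u (kernel_op K w) - L2_inner \<omega> v (kernel_op K w)"
  by (simp add: L2_inner_diff_left kernel_op_L2)

text \<open>The operator is additive only where both functions are integrable under
  \<open>K x\<close>. Moving it to the fixed factor \<open>w\<close> by symmetry leaves additivity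
  of the plain inner product, with no null set to track.\<close>

lemma form_add_right:
  "u \<in> L2 \<omega> \<Longrightarrow> v \<in> L2 \<omega> \<Longrightarrow> w \<in> L2 \<omega> \<Longrightarrow>
    L2_inner \<omega> w (kernel_op K (\<lambda>x. u x + v x)) = L2_inner \<omega> w (kernel_op K u) + L2_inner \<omega> w (kernel_op K v)"
  by (simp add: L2_inner_kernel_op_symmetric L2_add L2_inner_add_right kernel_op_L2)

lemma form_diff_right:
  "u \<in> L2 \<omega> \<Longrightarrow> v \<in> L2 \<omega> \<Longrightarrow> w \<in> L2 \<omega> \<Longrightarrow>
    L2_inner \<omega> w (kernel_op K (\<lambda>x. u x - v x)) = L2_inner \<omega> w (kernel_op K u) - L2_inner \<omega> w (kernel_op K v)"
  by (simp add: L2_inner_kernel_op_symmetric L2_diff L2_inner_diff_right kernel_op_L2)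

lemma kernel_op_scale: "kernel_op K (\<lambda>x. c * u x) = (\<lambda>x. c * kernel_op K u x)"
  by (simp add: kernel_op_def)

lemma form_commute:
  "u \<in> L2 \<omega> \<Longrightarrow> v \<in> L2 \<omega> \<Longrightarrow> L2_inner \<omega> u (kernel_op K v) = L2_inner \<omega> v (kernel_op K u)"
  by (subst L2_inner_kernel_op_symmetric) (simp_all add: L2_inner_commute[of \<omega> v])

end

section \<open>The variational principle\<close>

definition autocov :: "'s measure \<Rightarrow> ('s \<Rightarrow> 's measure) \<Rightarrow> ('s \<Rightarrow> real) \<Rightarrow> nat \<Rightarrow> real" where
  "autocov \<omega> K f s = L2_inner \<omega> f ((kernel_op K ^^ s) f)"

text \<open>The Dirichlet form without the centering. The two agree on \<open>L2\<close> because
  constants do not contribute, and without centering the form is directly quadratic in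
  \<open>g\<close>.\<close>

definition energy :: "'s measure \<Rightarrow> ('s \<Rightarrow> 's measure) \<Rightarrow> ('s \<Rightarrow> real) \<Rightarrow> real" where
  "energy \<omega> K g = L2_inner \<omega> g g - L2_inner \<omega> g (kernel_op K g)"

context reversible_chain
begin

lemma kernel_op_power_L2_0: "f \<in> L2_0 \<omega> \<Longrightarrow> (kernel_op K ^^ s) f \<in> L2_0 \<omega>"
  by (induction s) (auto intro: kernel_op_L2_0)

lemma kernel_op_power_L2: "f \<in> L2_0 \<omega> \<Longrightarrow> (kernel_op K ^^ s) f \<in> L2 \<omega>"
  by (intro L2_0_imp_L2 kernel_op_power_L2_0)

lemma L2_inner_kernel_op_power:
  assumes f: "f \<in> L2_0 \<omega>" and g: "g \<in> L2_0 \<omega>"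
  shows "L2_inner \<omega> ((kernel_op K ^^ s) g) ((kernel_op K ^^ t) f) = L2_inner \<omega> g ((kernel_op K ^^ (s + t)) f)"
  using f
proof (induction s arbitrary: t)
  case (Suc s)
  have "L2_inner \<omega> ((kernel_op K ^^ Suc s) g) ((kernel_op K ^^ t) f)
      = L2_inner \<omega> ((kernel_op K ^^ s) g) ((kernel_op K ^^ Suc t) f)"
    using Suc.prems g by (simp add: L2_inner_kernel_op_symmetric kernel_op_power_L2)
  also have "\<dots> = L2_inner \<omega> g ((kernel_op K ^^ (s + Suc t)) f)"
    using Suc by blast
  finally show ?case by simp
qed simp

text \<open>Polarization: the form is tested on \<open>K g \<plusminus> r g\<close>.\<close>

lemma form_bound_imp_operator_bound:
  assumes r: "0 < r" and g: "g \<in> L2_0 \<omega>"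
    and bound: "\<And>g. g \<in> L2_0 \<omega> \<Longrightarrow> \<bar>L2_inner \<omega> g (kernel_op K g)\<bar> \<le> r * L2_inner \<omega> g g"
  shows "L2_inner \<omega> (kernel_op K g) (kernel_op K g) \<le> r\<^sup>2 * L2_inner \<omega> g g"
proof -
  define u where "u = kernel_op K g"
  define v where "v = (\<lambda>x. r * g x)"
  have u: "u \<in> L2_0 \<omega>" and v: "v \<in> L2_0 \<omega>"
    using g by (auto simp: u_def v_def intro: kernel_op_L2_0 L2_0_scale)
  note L = L2_0_imp_L2[OF u] L2_0_imp_L2[OF v]
  have plus: "\<bar>L2_inner \<omega> (\<lambda>x. u x + v x) (kernel_op K (\<lambda>x. u x + v x))\<bar>
      \<le> r * L2_inner \<omega> (\<lambda>x. u x + v x) (\<lambda>x. u x + v x)"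
    by (rule bound[OF L2_0_add[OF u v]])
  have minus: "\<bar>L2_inner \<omega> (\<lambda>x. u x - v x) (kernel_op K (\<lambda>x. u x - v x))\<bar>
      \<le> r * L2_inner \<omega> (\<lambda>x. u x - v x) (\<lambda>x. u x - v x)"
    by (rule bound[OF L2_0_diff[OF u v]])
  have uv: "L2_inner \<omega> u (kernel_op K v) = r * L2_inner \<omega> u u"
    by (simp add: v_def kernel_op_scale L2_inner_scale_right u_def)
  have vu: "L2_inner \<omega> v (kernel_op K u) = r * L2_inner \<omega> u u"
    using uv form_commute[OF L] by simp
  have vv: "L2_inner \<omega> v v = r * (r * L2_inner \<omega> g g)"
    by (simp add: v_def L2_inner_scale_left L2_inner_scale_right)
  \<comment> \<open>The difference of the two forms retains only the four cross terms, each equal to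
    \<open>r ||u||^2\<close>. On the other side the parallelogram law leaves
    \<open>2 ||u||^2 + 2 ||v||^2\<close>, and half of the left-hand side absorbs the
    \<open>u\<close> part.\<close>
  have "4 * (r * L2_inner \<omega> u u) =
      L2_inner \<omega> (\<lambda>x. u x + v x) (kernel_op K (\<lambda>x. u x + v x))
      - L2_inner \<omega> (\<lambda>x. u x - v x) (kernel_op K (\<lambda>x. u x - v x))"
    using L by (simp add: form_add_left form_add_right form_diff_left form_diff_right L2_add L2_diff uv vu)
  also have "\<dots> \<le> r * L2_inner \<omega> (\<lambda>x. u x + v x) (\<lambda>x. u x + v x)
      + r * L2_inner \<omega> (\<lambda>x. u x - v x) (\<lambda>x. u x - v x)"
    using plus minus by linarith
  also have "\<dots> = r * (2 * L2_inner \<omega> u u + 2 * (r * (r * L2_inner \<omega> g g)))"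
    using L by (simp add: L2_inner_add_left L2_inner_add_right L2_inner_diff_left L2_inner_diff_right
        L2_add L2_diff vv algebra_simps)
  finally have "r * (2 * L2_inner \<omega> u u) \<le> r * (2 * (r * (r * L2_inner \<omega> g g)))"
    by (simp add: algebra_simps)
  then show ?thesis
    using r by (simp add: u_def power2_eq_square mult.assoc)
qed

text \<open>The contraction property is used twice: it bounds the set whose real supremum defines
  the norm, and it settles the case of a null \<open>g\<close>, which cannot be normalised.\<close>

lemma kernel_norm_bound:
  assumes g: "g \<in> L2_0 \<omega>"
  shows "L2_norm \<omega> (kernel_op K g) \<le> kernel_norm \<omega> K * L2_norm \<omega> g"
proof (cases "L2_norm \<omega> g = 0")
  case True
  have "(L2_norm \<omega> (kernel_op K g))\<^sup>2 \<le> (L2_norm \<omega> g)\<^sup>2"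
    using kernel_op_contraction[OF L2_0_imp_L2[OF g]] by (simp add: L2_norm_square)
  with True show ?thesis by simp
next
  case False
  have nonneg: "0 \<le> L2_norm \<omega> u" for u
    by (simp add: L2_norm_def L2_inner_nonneg)
  have scale: "L2_norm \<omega> (\<lambda>x. c * u x) = \<bar>c\<bar> * L2_norm \<omega> u" for c u
    by (simp add: L2_norm_def L2_inner_scale_left L2_inner_scale_right real_sqrt_mult mult.assoc[symmetric])
  define c where "c = inverse (L2_norm \<omega> g)"
  have c: "0 < c"
    using False nonneg[of g] by (simp add: c_def)
  have norm1: "L2_norm \<omega> (\<lambda>x. c * g x) \<le> 1"
    using c False by (simp add: scale) (simp add: c_def)
  have "bdd_above {L2_norm \<omega> (kernel_op K f) | f. f \<in> L2_0 \<omega> \<and> L2_norm \<omega> f \<le> 1}"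
  proof (rule bdd_aboveI)
    fix y assume "y \<in> {L2_norm \<omega> (kernel_op K f) | f. f \<in> L2_0 \<omega> \<and> L2_norm \<omega> f \<le> 1}"
    then obtain f where y: "y = L2_norm \<omega> (kernel_op K f)" and f: "f \<in> L2_0 \<omega>" "L2_norm \<omega> f \<le> 1"
      by blast
    have "L2_norm \<omega> (kernel_op K f) \<le> L2_norm \<omega> f"
      using kernel_op_contraction[OF L2_0_imp_L2[OF f(1)]] by (simp add: L2_norm_def)
    with f show "y \<le> 1" by (simp add: y)
  qed
  then have "L2_norm \<omega> (kernel_op K (\<lambda>x. c * g x)) \<le> kernel_norm \<omega> K"
    unfolding kernel_norm_def
    by (rule cSup_upper[rotated]) (use L2_0_scale[OF g, of c] norm1 in blast)
  then show ?thesis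
    using False c nonneg[of g] by (simp add: kernel_op_scale scale) (simp add: c_def field_simps)
qed

text \<open>The norm may be 0, so it is replaced by some positive \<open>k\<close> above it, which
  can serve as the weight in Young's inequality; both terms on the right are then at most
  \<open>k ||g||^2\<close>.\<close>

lemma kernel_norm_form_bound:
  assumes g: "g \<in> L2_0 \<omega>" and k: "kernel_norm \<omega> K \<le> k" "0 < k"
  shows "L2_inner \<omega> g (kernel_op K g) \<le> k * L2_inner \<omega> g g"
proof -
  have nonneg: "0 \<le> L2_norm \<omega> u" for u
    by (simp add: L2_norm_def L2_inner_nonneg)
  have "L2_norm \<omega> (kernel_op K g) \<le> k * L2_norm \<omega> g"
    using kernel_norm_bound[OF g] mult_right_mono[OF k(1) nonneg[of g]] by linarith
  then have "(L2_norm \<omega> (kernel_op K g))\<^sup>2 \<le> (k * L2_norm \<omega> g)\<^sup>2"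
    by (rule power_mono) (rule nonneg)
  then have "L2_inner \<omega> (kernel_op K g) (kernel_op K g) / k \<le> k * L2_inner \<omega> g g"
    unfolding power_mult_distrib L2_norm_square using k by (simp add: power2_eq_square field_simps)
  moreover have "2 * \<bar>L2_inner \<omega> g (kernel_op K g)\<bar>
      \<le> k * L2_inner \<omega> g g + L2_inner \<omega> (kernel_op K g) (kernel_op K g) / k"
    using g k by (intro L2_inner_le_scaled) (auto intro: L2_0_imp_L2 kernel_op_L2)
  ultimately show ?thesis
    by linarith
qed

end

text \<open>A spectral gap at both ends, expressed through norms. The number \<open>r\<close> is any
  valid bound rather than the norm itself and is kept positive because powers of it are used as
  weights and divisors.\<close>

locale contractive_chain = reversible_chain \<omega> K for \<omega> :: "'s measure" and K +
  fixes r :: real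
  assumes r_pos: "0 < r" and r_less: "r < 1"
    and contractive: "g \<in> L2_0 \<omega> \<Longrightarrow> L2_inner \<omega> (kernel_op K g) (kernel_op K g) \<le> r\<^sup>2 * L2_inner \<omega> g g"
begin

lemma kernel_op_power_norm:
  assumes f: "f \<in> L2_0 \<omega>"
  shows "L2_inner \<omega> ((kernel_op K ^^ s) f) ((kernel_op K ^^ s) f) \<le> (r ^ s)\<^sup>2 * L2_inner \<omega> f f"
proof (induction s)
  case (Suc s)
  have "L2_inner \<omega> ((kernel_op K ^^ Suc s) f) ((kernel_op K ^^ Suc s) f)
      \<le> r\<^sup>2 * L2_inner \<omega> ((kernel_op K ^^ s) f) ((kernel_op K ^^ s) f)"
    using contractive[OF kernel_op_power_L2_0[OF f]] by simp
  also have "\<dots> \<le> r\<^sup>2 * ((r ^ s)\<^sup>2 * L2_inner \<omega> f f)"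
    by (intro mult_left_mono Suc) simp
  finally show ?case
    by (simp add: power_mult_distrib mult.assoc)
qed simp

text \<open>The weight \<open>r ^ s\<close> balances the two terms of Young's inequality, since the
  squared norm of the iterate carries \<open>r ^ s\<close> twice. An arithmetic mean of squared
  norms thus replaces their geometric mean.\<close>

lemma inner_decay:
  assumes f: "f \<in> L2_0 \<omega>" and g: "g \<in> L2_0 \<omega>"
  shows "\<bar>L2_inner \<omega> g ((kernel_op K ^^ s) f)\<bar> \<le> (L2_inner \<omega> g g + L2_inner \<omega> f f) / 2 * r ^ s"
proof -
  have "2 * \<bar>L2_inner \<omega> g ((kernel_op K ^^ s) f)\<bar>
      \<le> r ^ s * L2_inner \<omega> g g + L2_inner \<omega> ((kernel_op K ^^ s) f) ((kernel_op K ^^ s) f) / r ^ s"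
    using f g r_pos by (intro L2_inner_le_scaled) (auto intro: L2_0_imp_L2 kernel_op_power_L2)
  also have "\<dots> \<le> r ^ s * L2_inner \<omega> g g + (r ^ s)\<^sup>2 * L2_inner \<omega> f f / r ^ s"
    using kernel_op_power_norm[OF f, of s] r_pos by (intro add_left_mono divide_right_mono) auto
  also have "\<dots> = r ^ s * (L2_inner \<omega> g g + L2_inner \<omega> f f)"
    using r_pos by (simp add: power2_eq_square algebra_simps)
  finally show ?thesis
    by (simp add: mult.commute)
qed

lemma inner_tendsto_0:
  assumes f: "f \<in> L2_0 \<omega>" and g: "g \<in> L2_0 \<omega>"
  shows "(\<lambda>s. L2_inner \<omega> g ((kernel_op K ^^ s) f)) \<longlonglongrightarrow> 0"
proof (rule Lim_null_comparison[OF always_eventually])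
  show "\<forall>s. norm (L2_inner \<omega> g ((kernel_op K ^^ s) f)) \<le> (L2_inner \<omega> g g + L2_inner \<omega> f f) / 2 * r ^ s"
    using inner_decay[OF f g] by simp
  show "(\<lambda>s. (L2_inner \<omega> g g + L2_inner \<omega> f f) / 2 * r ^ s) \<longlonglongrightarrow> 0"
    using r_pos r_less by (intro tendsto_mult_right_zero LIMSEQ_power_zero) auto
qed

lemma summable_autocov:
  assumes f: "f \<in> L2_0 \<omega>"
  shows "summable (autocov \<omega> K f)"
proof (rule summable_comparison_test')
  show "summable (\<lambda>s. (L2_inner \<omega> f f + L2_inner \<omega> f f) / 2 * r ^ s)"
    using r_pos r_less by (intro summable_mult summable_geometric) auto
  show "norm (autocov \<omega> K f s) \<le> (L2_inner \<omega> f f + L2_inner \<omega> f f) / 2 * r ^ s" for s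
    using inner_decay[OF f f, of s] by (simp add: autocov_def)
qed

text \<open>The partial sums of the Neumann series of \<open>(I - K)\<^sup>-\<^sup>1 f\<close> replace its limit, so that no
  completeness of \<open>L\<^sup>2\<close> is needed.\<close>

definition neumann :: "('s \<Rightarrow> real) \<Rightarrow> nat \<Rightarrow> 's \<Rightarrow> real" where
  "neumann f N = (\<lambda>x. \<Sum>s<N. (kernel_op K ^^ s) f x)"

lemma neumann_L2_0: "f \<in> L2_0 \<omega> \<Longrightarrow> neumann f N \<in> L2_0 \<omega>"
  unfolding neumann_def by (intro L2_0_sum kernel_op_power_L2_0)

lemma inner_neumann:
  "f \<in> L2_0 \<omega> \<Longrightarrow> g \<in> L2 \<omega> \<Longrightarrow> L2_inner \<omega> g (neumann f N) = (\<Sum>s<N. L2_inner \<omega> g ((kernel_op K ^^ s) f))"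
  unfolding neumann_def by (intro L2_inner_sum_right kernel_op_power_L2)

text \<open>This is \<open>(I - K)(f + ... + K^(N-1) f) = f - K^N f\<close>, tested against
  \<open>g\<close>. One power of \<open>K\<close> passes to \<open>g\<close> by symmetry and back as
  an exponent, so the telescoping takes place among real numbers.\<close>

lemma form_neumann:
  assumes f: "f \<in> L2_0 \<omega>" and g: "g \<in> L2_0 \<omega>"
  shows "L2_inner \<omega> g (neumann f N) - L2_inner \<omega> g (kernel_op K (neumann f N))
    = L2_inner \<omega> g f - L2_inner \<omega> g ((kernel_op K ^^ N) f)"
proof -
  have "L2_inner \<omega> g (kernel_op K (neumann f N)) = (\<Sum>s<N. L2_inner \<omega> (kernel_op K g) ((kernel_op K ^^ s) f))"
    using f g by (simp add: L2_inner_kernel_op_symmetric L2_0_imp_L2 neumann_L2_0 inner_neumann kernel_op_L2)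
  also have "\<dots> = (\<Sum>s<N. L2_inner \<omega> g ((kernel_op K ^^ Suc s) f))"
    using L2_inner_kernel_op_power[OF f g, of 1] by simp
  finally show ?thesis
    using f g sum_lessThan_telescope'[of "\<lambda>s. L2_inner \<omega> g ((kernel_op K ^^ s) f)" N]
    by (simp add: inner_neumann L2_0_imp_L2 sum_subtractf)
qed

text \<open>By symmetry the remainder is the sum of the autocovariances with lags from
  \<open>N\<close> to \<open>2N - 1\<close>, a block of a convergent series.\<close>

lemma neumann_remainder:
  assumes f: "f \<in> L2_0 \<omega>"
  shows "(\<lambda>N. L2_inner \<omega> (neumann f N) ((kernel_op K ^^ N) f)) \<longlonglongrightarrow> 0"
proof -
  let ?A = "\<lambda>N. \<Sum>s<N. autocov \<omega> K f s"
  have eq: "L2_inner \<omega> (neumann f N) ((kernel_op K ^^ N) f) = ?A (N + N) - ?A N" for N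
  proof -
    have "L2_inner \<omega> (neumann f N) ((kernel_op K ^^ N) f)
        = (\<Sum>s<N. L2_inner \<omega> ((kernel_op K ^^ N) f) ((kernel_op K ^^ s) f))"
      using f by (simp add: L2_inner_commute[of \<omega> "neumann f N"] inner_neumann kernel_op_power_L2)
    also have "\<dots> = (\<Sum>s<N. autocov \<omega> K f (N + s))"
      by (simp add: L2_inner_kernel_op_power f autocov_def)
    also have "\<dots> = ?A (N + N) - ?A N"
    proof -
      have "?A (m + n) = ?A m + (\<Sum>s<n. autocov \<omega> K f (m + s))" for m n
        by (induction n) simp_all
      then show ?thesis by simp
    qed
    finally show ?thesis .
  qed
  have A: "?A \<longlonglongrightarrow> suminf (autocov \<omega> K f)"
    by (rule summable_LIMSEQ[OF summable_autocov[OF f]])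
  have "(\<lambda>N. ?A (N + N)) \<longlonglongrightarrow> suminf (autocov \<omega> K f)"
    by (rule filterlim_compose[OF A]) (auto intro!: filterlim_subseq strict_monoI)
  from tendsto_diff[OF this A] show ?thesis
    by (simp add: eq)
qed

text \<open>Testing the telescoping identity on the Neumann sum itself gives its energy as the
  linear term minus the vanishing remainder. Both share one limit, so the functional
  \<open>2 <f, g> - E(g)\<close> tends to that limit along the Neumann sums.\<close>

lemma
  assumes f: "f \<in> L2_0 \<omega>"
  shows inner_neumann_tendsto: "(\<lambda>N. L2_inner \<omega> f (neumann f N)) \<longlonglongrightarrow> suminf (autocov \<omega> K f)"
    and energy_neumann_tendsto: "(\<lambda>N. energy \<omega> K (neumann f N)) \<longlonglongrightarrow> suminf (autocov \<omega> K f)"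
proof -
  show lim: "(\<lambda>N. L2_inner \<omega> f (neumann f N)) \<longlonglongrightarrow> suminf (autocov \<omega> K f)"
    using summable_LIMSEQ[OF summable_autocov[OF f]] f
    by (simp add: inner_neumann L2_0_imp_L2 autocov_def)
  have "(\<lambda>N. L2_inner \<omega> f (neumann f N) - L2_inner \<omega> (neumann f N) ((kernel_op K ^^ N) f))
      \<longlonglongrightarrow> suminf (autocov \<omega> K f) - 0"
    by (intro tendsto_diff lim neumann_remainder f)
  then show "(\<lambda>N. energy \<omega> K (neumann f N)) \<longlonglongrightarrow> suminf (autocov \<omega> K f)"
    unfolding energy_def form_neumann[OF f neumann_L2_0[OF f]] L2_inner_commute[of \<omega> "neumann f _" f]
    by simp
qed

lemma energy_nonneg:
  assumes g: "g \<in> L2_0 \<omega>"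
  shows "0 \<le> energy \<omega> K g"
  using L2_inner_le_scaled[of g \<omega> "kernel_op K g" 1] kernel_op_contraction[of g] kernel_op_L2[of g] L2_0_imp_L2[OF g]
  by (simp add: energy_def)

text \<open>Completing the square: the nonnegative energy of \<open>g\<close> minus a Neumann sum is
  expanded, and the telescoping identity turns the cross term into \<open><g, f>\<close> up to a
  term that tends to 0.\<close>

lemma variational_bound:
  assumes f: "f \<in> L2_0 \<omega>" and g: "g \<in> L2_0 \<omega>"
  shows "2 * L2_inner \<omega> f g - energy \<omega> K g \<le> suminf (autocov \<omega> K f)"
proof (rule LIMSEQ_le_const)
  let ?g = "neumann f"
  show "(\<lambda>N. energy \<omega> K (?g N) + 2 * L2_inner \<omega> g ((kernel_op K ^^ N) f)) \<longlonglongrightarrow> suminf (autocov \<omega> K f)"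
    using tendsto_add[OF energy_neumann_tendsto[OF f] tendsto_mult_right_zero[OF inner_tendsto_0[OF f g], of 2]]
    by simp
  show "\<exists>N. \<forall>n\<ge>N. 2 * L2_inner \<omega> f g - energy \<omega> K g
      \<le> energy \<omega> K (?g n) + 2 * L2_inner \<omega> g ((kernel_op K ^^ n) f)"
  proof (intro exI allI impI)
    fix N :: nat
    note L = L2_0_imp_L2[OF g] L2_0_imp_L2[OF neumann_L2_0[OF f, of N]]
    have "0 \<le> energy \<omega> K (\<lambda>x. g x - ?g N x)"
      by (intro energy_nonneg L2_0_diff g neumann_L2_0 f)
    also have "\<dots> = energy \<omega> K g + energy \<omega> K (?g N)
        - 2 * (L2_inner \<omega> g (?g N) - L2_inner \<omega> g (kernel_op K (?g N)))"
      using L form_commute[OF L]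
      by (simp add: energy_def form_diff_left form_diff_right L2_inner_diff_left L2_inner_diff_right
          L2_diff L2_inner_commute[of \<omega> "?g N" g])
    finally show "2 * L2_inner \<omega> f g - energy \<omega> K g
        \<le> energy \<omega> K (?g N) + 2 * L2_inner \<omega> g ((kernel_op K ^^ N) f)"
      unfolding form_neumann[OF f g] L2_inner_commute[of \<omega> f g] by simp
  qed
qed

end

lemma energy_scale: "energy \<omega> K (\<lambda>x. c * g x) = c\<^sup>2 * energy \<omega> K g"
proof -
  have "kernel_op K (\<lambda>x. c * g x) = (\<lambda>x. c * kernel_op K g x)"
    by (simp add: kernel_op_def)
  then show ?thesis
    by (simp add: energy_def L2_inner_scale_left L2_inner_scale_right power2_eq_square algebra_simps)
qed

text \<open>The Neumann sums of \<open>K1\<close> are asymptotically optimal for the functional of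
  \<open>K1\<close>; rescaled, they are merely admissible for the functional of \<open>K2\<close>.
  This is where the inequality between energies is reversed.\<close>

lemma suminf_autocov_mono:
  assumes K1: "contractive_chain \<omega> K1 r1" and K2: "contractive_chain \<omega> K2 r2"
    and c: "0 < c" and le: "\<And>g. g \<in> L2_0 \<omega> \<Longrightarrow> energy \<omega> K2 g \<le> c * energy \<omega> K1 g"
    and f: "f \<in> L2_0 \<omega>"
  shows "suminf (autocov \<omega> K1 f) \<le> c * suminf (autocov \<omega> K2 f)"
proof -
  interpret K1: contractive_chain \<omega> K1 r1 by (rule K1)
  interpret K2: contractive_chain \<omega> K2 r2 by (rule K2)
  let ?g = "K1.neumann f"
  have "(\<lambda>N. 2 * L2_inner \<omega> f (?g N) - energy \<omega> K1 (?g N))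
      \<longlonglongrightarrow> 2 * suminf (autocov \<omega> K1 f) - suminf (autocov \<omega> K1 f)"
    by (intro tendsto_intros K1.inner_neumann_tendsto K1.energy_neumann_tendsto f)
  moreover have "2 * L2_inner \<omega> f (?g N) - energy \<omega> K1 (?g N) \<le> c * suminf (autocov \<omega> K2 f)" for N
  proof -
    \<comment> \<open>With the factor \<open>1 / c\<close> the linear term scales by
      \<open>1 / c\<close>, and the energy is by \<open>le\<close> at most
      \<open>c / c\<^sup>2\<close> times that of \<open>K1\<close>. Multiplication by
      \<open>c\<close> then restores the functional of \<open>K1\<close>.\<close>
    have "2 * L2_inner \<omega> f (\<lambda>x. inverse c * ?g N x) - energy \<omega> K2 (\<lambda>x. inverse c * ?g N x)
        \<le> suminf (autocov \<omega> K2 f)"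
      by (intro K2.variational_bound f L2_0_scale K1.neumann_L2_0)
    then have "c * (2 * inverse c * L2_inner \<omega> f (?g N) - (inverse c)\<^sup>2 * energy \<omega> K2 (?g N))
        \<le> c * suminf (autocov \<omega> K2 f)"
      using c by (intro mult_left_mono) (auto simp: energy_scale L2_inner_scale_right)
    moreover have "c * (2 * inverse c * L2_inner \<omega> f (?g N) - (inverse c)\<^sup>2 * energy \<omega> K2 (?g N))
        = 2 * L2_inner \<omega> f (?g N) - inverse c * energy \<omega> K2 (?g N)"
      using c by (simp add: power2_eq_square field_simps)
    moreover have "inverse c * energy \<omega> K2 (?g N) \<le> inverse c * (c * energy \<omega> K1 (?g N))"
      using c by (intro mult_left_mono le K1.neumann_L2_0 f) auto
    ultimately show ?thesis
      using c by (simp add: mult.assoc[symmetric])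
  qed
  ultimately show ?thesis
    by (intro LIMSEQ_le_const2[where X = "\<lambda>N. 2 * L2_inner \<omega> f (?g N) - energy \<omega> K1 (?g N)"]) auto
qed

section \<open>Asymptotic variance of the stationary chain\<close>

context reversible_chain
begin

section \<open>Finite-dimensional laws and covariances of the trajectory\<close>

sublocale chain: Ionescu_Tulcea "chain_step \<omega> K" "\<lambda>_. \<omega>"
proof (rule Ionescu_Tulcea.intro)
  show "chain_step \<omega> K i \<in> measurable (PiM {0..<i} (\<lambda>_. \<omega>)) (subprob_algebra \<omega>)" for i
    by (cases i) (simp_all add: chain_step_def[abs_def] M_in_subprob)
  show "prob_space (chain_step \<omega> K i x)" if "x \<in> space (PiM {0..<i} (\<lambda>_. \<omega>))" for i x
  proof (cases i)
    case (Suc j)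
    with that have "x j \<in> space \<omega>"
      by (auto simp: space_PiM)
    with Suc show ?thesis
      by (simp add: chain_step_def prob_kernel)
  qed (simp add: chain_step_def prob_space_axioms)
qed

abbreviation trajectory :: "(nat \<Rightarrow> 's) measure" where "trajectory \<equiv> chain_law \<omega> K"

lemma sets_trajectory[simp, measurable_cong]: "sets trajectory = sets (PiM UNIV (\<lambda>_. \<omega>))"
  by (simp add: chain_law_def)

lemma coord_measurable[measurable]: "(\<lambda>\<xi>. \<xi> s) \<in> measurable trajectory \<omega>"
  by (simp cong: measurable_cong_sets)

lemma restrict_trajectory[measurable]:
  "(\<lambda>\<xi>. restrict \<xi> J) \<in> measurable trajectory (PiM J (\<lambda>_. \<omega>))"
  by (rule measurable_restrict) simp

lemma prob_space_trajectory: "prob_space trajectory"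
proof -
  \<comment> \<open>The projection onto no coordinates at all already carries the total
    mass.\<close>
  have "prob_space (distr trajectory (PiM {} (\<lambda>_. \<omega>)) (\<lambda>\<xi>. restrict \<xi> {}))"
    unfolding chain_law_def by (subst chain.distr_lim) (auto intro: chain.PF.prob_space_P)
  then show ?thesis
    by (rule prob_space_distrD[rotated]) simp
qed

text \<open>The limit measure is accessible only through finite projections. For an initial segment
  of times the projection is the \<open>n\<close>-step measure, whose integrals can be peeled off
  one state at a time.\<close>

lemma nn_integral_trajectory:
  assumes F[measurable]: "F \<in> borel_measurable (PiM {0..<n} (\<lambda>_. \<omega>))"
  shows "(\<integral>\<^sup>+\<xi>. F (restrict \<xi> {0..<n}) \<partial>trajectory) = (\<integral>\<^sup>+w. F w \<partial>chain.C 0 n (\<lambda>_. undefined))"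
proof -
  \<comment> \<open>\<open>CI J\<close> restricts the law up to stage \<open>up_to J\<close>. For an
    initial segment this stage is exactly \<open>n\<close>, so the restriction acts as the
    identity.\<close>
  have up: "chain.up_to {0..<n} = n"
  proof (rule antisym)
    show "chain.up_to {0..<n} \<le> n"
      by (simp add: chain.up_to_iff_Ico)
    show "n \<le> chain.up_to {0..<n}"
      using chain.up_to_less[of "{0..<n}" "n - 1"] by (cases n) auto
  qed
  \<comment> \<open>The empty history, the only point of the product over no indices.\<close>
  have u: "(\<lambda>_. undefined) \<in> space (PiM {0..<0::nat} (\<lambda>_. \<omega>))"
    by (simp add: space_PiM)
  note sC = chain.sets_C[OF u, of n, simplified]
  have "(\<integral>\<^sup>+\<xi>. F (restrict \<xi> {0..<n}) \<partial>trajectory)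
      = (\<integral>\<^sup>+w. F w \<partial>distr trajectory (PiM {0..<n} (\<lambda>_. \<omega>)) (\<lambda>\<xi>. restrict \<xi> {0..<n}))"
    by (subst nn_integral_distr) simp_all
  also have "distr trajectory (PiM {0..<n} (\<lambda>_. \<omega>)) (\<lambda>\<xi>. restrict \<xi> {0..<n}) = chain.CI {0..<n}"
    unfolding chain_law_def by (rule chain.distr_lim) simp
  also have "(\<integral>\<^sup>+w. F w \<partial>chain.CI {0..<n}) = (\<integral>\<^sup>+w. F (restrict w {0..<n}) \<partial>chain.C 0 n (\<lambda>_. undefined))"
    unfolding chain.CI_def up
    by (subst nn_integral_distr) (auto simp: sC cong: measurable_cong_sets intro!: measurable_restrict)
  also have "\<dots> = (\<integral>\<^sup>+w. F w \<partial>chain.C 0 n (\<lambda>_. undefined))"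
    using chain.space_C[OF u, of n]
    by (intro nn_integral_cong arg_cong[where f = F]) (auto simp: space_PiM PiE_restrict)
  finally show ?thesis .
qed

lemma nn_integral_C_Suc:
  assumes F: "F \<in> borel_measurable (PiM {0..<Suc n} (\<lambda>_. \<omega>))"
  shows "(\<integral>\<^sup>+w. F w \<partial>chain.C 0 (Suc n) (\<lambda>_. undefined))
    = (\<integral>\<^sup>+w. \<integral>\<^sup>+z. F (w(n := z)) \<partial>chain_step \<omega> K n w \<partial>chain.C 0 n (\<lambda>_. undefined))"
proof -
  have u: "(\<lambda>_. undefined) \<in> space (PiM {0..<0::nat} (\<lambda>_. \<omega>))"
    by (simp add: space_PiM)
  have eP: "chain.eP n \<in> measurable (chain.C 0 n (\<lambda>_. undefined)) (subprob_algebra (PiM {0..<Suc n} (\<lambda>_. \<omega>)))"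
    using chain.measurable_eP[of n] chain.sets_C[OF u, of n] by (simp cong: measurable_cong_sets)
  have "(\<integral>\<^sup>+w. F w \<partial>chain.C 0 (Suc n) (\<lambda>_. undefined))
      = (\<integral>\<^sup>+w. \<integral>\<^sup>+v. F v \<partial>chain.eP n w \<partial>chain.C 0 n (\<lambda>_. undefined))"
    using nn_integral_bind[OF F eP] by simp
  also have "\<dots> = (\<integral>\<^sup>+w. \<integral>\<^sup>+z. F (w(n := z)) \<partial>chain_step \<omega> K n w \<partial>chain.C 0 n (\<lambda>_. undefined))"
    using chain.space_C[OF u, of n] by (intro nn_integral_cong chain.nn_integral_eP F) simp
  finally show ?thesis .
qed

text \<open>The Markov property with just enough of the past for covariances: one earlier state, the
  present and the next one. The condition \<open>i \<le> m\<close> keeps the two remembered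
  coordinates untouched when the state at \<open>Suc m\<close> is written.\<close>

lemma nn_integral_step:
  assumes G[measurable]: "G \<in> borel_measurable ((\<omega> \<Otimes>\<^sub>M \<omega>) \<Otimes>\<^sub>M \<omega>)" and i: "i \<le> m"
  shows "(\<integral>\<^sup>+\<xi>. G ((\<xi> i, \<xi> m), \<xi> (Suc m)) \<partial>trajectory)
    = (\<integral>\<^sup>+\<xi>. \<integral>\<^sup>+z. G ((\<xi> i, \<xi> m), z) \<partial>K (\<xi> m) \<partial>trajectory)"
proof -
  let ?F = "\<lambda>w. G ((w i, w m), w (Suc m))"
  let ?H = "\<lambda>w. \<integral>\<^sup>+z. G ((w i, w m), z) \<partial>K (w m)"
  have [measurable]: "(\<lambda>w. w j) \<in> measurable (PiM {0..<n} (\<lambda>_. \<omega>)) \<omega>"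
    if "j \<in> {0..<n}" for j n :: nat
    by (rule measurable_component_singleton[OF that])
  have F: "?F \<in> borel_measurable (PiM {0..<Suc (Suc m)} (\<lambda>_. \<omega>))"
    using i by (measurable; simp)
  have H: "?H \<in> borel_measurable (PiM {0..<Suc m} (\<lambda>_. \<omega>))"
  proof (rule nn_integral_measurable_subprob_algebra2[where N = \<omega>])
    show "(\<lambda>(w, z). G ((w i, w m), z)) \<in> borel_measurable (PiM {0..<Suc m} (\<lambda>_. \<omega>) \<Otimes>\<^sub>M \<omega>)"
      using i by (measurable; simp)
    show "(\<lambda>w. K (w m)) \<in> measurable (PiM {0..<Suc m} (\<lambda>_. \<omega>)) (subprob_algebra \<omega>)"
      by (measurable; simp)
  qed
  have "(\<integral>\<^sup>+\<xi>. ?F \<xi> \<partial>trajectory) = (\<integral>\<^sup>+\<xi>. ?F (restrict \<xi> {0..<Suc (Suc m)}) \<partial>trajectory)"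
    using i by simp
  also have "\<dots> = (\<integral>\<^sup>+w. ?F w \<partial>chain.C 0 (Suc (Suc m)) (\<lambda>_. undefined))"
    by (rule nn_integral_trajectory[OF F])
  also have "\<dots> = (\<integral>\<^sup>+w. ?H w \<partial>chain.C 0 (Suc m) (\<lambda>_. undefined))"
    using i by (subst nn_integral_C_Suc[OF F]) (simp add: chain_step_def)
  also have "\<dots> = (\<integral>\<^sup>+\<xi>. ?H (restrict \<xi> {0..<Suc m}) \<partial>trajectory)"
    by (rule nn_integral_trajectory[OF H, symmetric])
  also have "\<dots> = (\<integral>\<^sup>+\<xi>. ?H \<xi> \<partial>trajectory)"
    using i by simp
  finally show ?thesis .
qed

lemma nn_integral_coord:
  assumes u[measurable]: "u \<in> borel_measurable \<omega>"
  shows "(\<integral>\<^sup>+\<xi>. u (\<xi> s) \<partial>trajectory) = (\<integral>\<^sup>+x. u x \<partial>\<omega>)"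
  using u
proof (induction s arbitrary: u)
  case 0
  note [measurable] = 0
  have F: "(\<lambda>w. u (w 0)) \<in> borel_measurable (PiM {0..<Suc 0} (\<lambda>_. \<omega>))"
    by measurable
  have "(\<integral>\<^sup>+\<xi>. u (\<xi> 0) \<partial>trajectory) = (\<integral>\<^sup>+\<xi>. u (restrict \<xi> {0..<Suc 0} 0) \<partial>trajectory)"
    by simp
  also have "\<dots> = (\<integral>\<^sup>+w. u (w 0) \<partial>chain.C 0 (Suc 0) (\<lambda>_. undefined))"
    by (rule nn_integral_trajectory[OF F])
  also have "\<dots> = (\<integral>\<^sup>+x. u x \<partial>\<omega>)"
    by (subst nn_integral_C_Suc[OF F])
       (simp add: chain_step_def space_PiM sets_PiM_empty)
  finally show ?case .
next
  case (Suc s)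
  note [measurable] = Suc.prems
  have "(\<integral>\<^sup>+\<xi>. u (\<xi> (Suc s)) \<partial>trajectory) = (\<integral>\<^sup>+\<xi>. \<integral>\<^sup>+z. u z \<partial>K (\<xi> s) \<partial>trajectory)"
    using nn_integral_step[of "\<lambda>w. u (snd w)" s s] by simp
  also have "\<dots> = (\<integral>\<^sup>+x. \<integral>\<^sup>+z. u z \<partial>K x \<partial>\<omega>)"
    using nn_integral_kernel_measurable[of "\<lambda>w. u (snd w)"] by (intro Suc.IH) simp
  also have "\<dots> = (\<integral>\<^sup>+x. u x \<partial>\<omega>)"
    by (rule nn_integral_invariant) simp
  finally show ?case .
qed

lemma distr_coord: "distr trajectory \<omega> (\<lambda>\<xi>. \<xi> s) = \<omega>"
proof (rule measure_eqI)
  fix A assume "A \<in> sets (distr trajectory \<omega> (\<lambda>\<xi>. \<xi> s))"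
  then have [measurable]: "A \<in> sets \<omega>" by simp
  have "emeasure (distr trajectory \<omega> (\<lambda>\<xi>. \<xi> s)) A = (\<integral>\<^sup>+x. indicator A x \<partial>distr trajectory \<omega> (\<lambda>\<xi>. \<xi> s))"
    by simp
  also have "\<dots> = (\<integral>\<^sup>+\<xi>. indicator A (\<xi> s) \<partial>trajectory)"
    by (rule nn_integral_distr) simp_all
  finally show "emeasure (distr trajectory \<omega> (\<lambda>\<xi>. \<xi> s)) A = emeasure \<omega> A"
    by (simp add: nn_integral_coord)
qed simp

lemma
  fixes u :: "'s \<Rightarrow> real"
  assumes u: "u \<in> borel_measurable \<omega>"
  shows integral_coord: "(\<integral>\<xi>. u (\<xi> s) \<partial>trajectory) = (\<integral>x. u x \<partial>\<omega>)"
    and integrable_coord: "integrable trajectory (\<lambda>\<xi>. u (\<xi> s)) \<longleftrightarrow> integrable \<omega> u"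
  using integral_distr[OF coord_measurable u] integrable_distr_eq[OF coord_measurable u]
  by (simp_all add: distr_coord)

lemma L2_coord:
  assumes u: "u \<in> L2 \<omega>"
  shows "(\<lambda>\<xi>. u (\<xi> s)) \<in> L2 trajectory"
proof -
  note [measurable] = L2_measurable[OF u]
  have "(\<lambda>\<xi>. u (\<xi> s)) \<in> borel_measurable trajectory"
    by (rule measurable_compose[OF coord_measurable]) measurable
  moreover have "integrable trajectory (\<lambda>\<xi>. (u (\<xi> s))\<^sup>2)"
    by (subst integrable_coord[where u = "\<lambda>x. (u x)\<^sup>2"]) (auto intro: L2_integrable_square u)
  ultimately show ?thesis
    by (simp add: L2_def)
qed

text \<open>Products \<open>u v\<close> have no sign, so the Markov property for nonnegative
  integrands first identifies the law of the triple of states as a kernel product whose kernel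
  ignores the oldest state. Fubini for integrable functions on that product then integrates out the
  newest state.\<close>

lemma integral_coord_step:
  assumes u: "u \<in> L2 \<omega>" and v: "v \<in> L2 \<omega>" and i: "i \<le> m"
  shows "(\<integral>\<xi>. u (\<xi> i) * v (\<xi> (Suc m)) \<partial>trajectory) = (\<integral>\<xi>. u (\<xi> i) * kernel_op K v (\<xi> m) \<partial>trajectory)"
proof -
  note [measurable] = L2_measurable[OF u] L2_measurable[OF v]
  interpret T: prob_space trajectory by (rule prob_space_trajectory)
  let ?P = "distr trajectory (\<omega> \<Otimes>\<^sub>M \<omega>) (\<lambda>\<xi>. (\<xi> i, \<xi> m))"
  interpret P: prob_space ?P by (rule T.prob_space_distr) simp
  interpret PK: prob_kernel ?P \<omega> "\<lambda>w. K (snd w)"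
    by unfold_locales simp
  let ?t = "\<lambda>\<xi>. ((\<xi> i, \<xi> m), \<xi> (Suc m))"
  have t: "?t \<in> measurable trajectory ((\<omega> \<Otimes>\<^sub>M \<omega>) \<Otimes>\<^sub>M \<omega>)"
    by simp
  have law: "distr trajectory ((\<omega> \<Otimes>\<^sub>M \<omega>) \<Otimes>\<^sub>M \<omega>) ?t = kernel_prod ?P \<omega> (\<lambda>w. K (snd w))"
  proof (rule measure_eqI)
    show s: "sets (distr trajectory ((\<omega> \<Otimes>\<^sub>M \<omega>) \<Otimes>\<^sub>M \<omega>) ?t) = sets (kernel_prod ?P \<omega> (\<lambda>w. K (snd w)))"
      by (simp cong: sets_pair_measure_cong)
    fix A assume "A \<in> sets (distr trajectory ((\<omega> \<Otimes>\<^sub>M \<omega>) \<Otimes>\<^sub>M \<omega>) ?t)"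
    then have A[measurable]: "A \<in> sets ((\<omega> \<Otimes>\<^sub>M \<omega>) \<Otimes>\<^sub>M \<omega>)" and A': "A \<in> sets (kernel_prod ?P \<omega> (\<lambda>w. K (snd w)))"
      using s by auto
    let ?I = "indicator A :: _ \<Rightarrow> ennreal"
    have I: "?I \<in> borel_measurable (?P \<Otimes>\<^sub>M \<omega>)"
      using A by (simp cong: measurable_cong_sets sets_pair_measure_cong)
    have "emeasure (distr trajectory ((\<omega> \<Otimes>\<^sub>M \<omega>) \<Otimes>\<^sub>M \<omega>) ?t) A
        = (\<integral>\<^sup>+w. ?I w \<partial>distr trajectory ((\<omega> \<Otimes>\<^sub>M \<omega>) \<Otimes>\<^sub>M \<omega>) ?t)"
      by simp
    also have "\<dots> = (\<integral>\<^sup>+\<xi>. ?I (?t \<xi>) \<partial>trajectory)"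
      by (rule nn_integral_distr[OF t]) simp
    also have "\<dots> = (\<integral>\<^sup>+\<xi>. \<integral>\<^sup>+z. ?I ((\<xi> i, \<xi> m), z) \<partial>K (\<xi> m) \<partial>trajectory)"
      by (rule nn_integral_step[OF _ i]) simp
    also have "\<dots> = (\<integral>\<^sup>+w. \<integral>\<^sup>+z. ?I (w, z) \<partial>K (snd w) \<partial>?P)"
      using PK.nn_integral_kernel_measurable[OF I] by (subst nn_integral_distr) simp_all
    also have "\<dots> = (\<integral>\<^sup>+w. ?I w \<partial>kernel_prod ?P \<omega> (\<lambda>w. K (snd w)))"
      by (rule PK.nn_integral_kernel_prod[OF I, symmetric])
    also have "\<dots> = emeasure (kernel_prod ?P \<omega> (\<lambda>w. K (snd w))) A"
      by (rule nn_integral_indicator[OF A'])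
    finally show "emeasure (distr trajectory ((\<omega> \<Otimes>\<^sub>M \<omega>) \<Otimes>\<^sub>M \<omega>) ?t) A = emeasure (kernel_prod ?P \<omega> (\<lambda>w. K (snd w))) A" .
  qed
  let ?F = "\<lambda>w. u (fst (fst w)) * v (snd w)"
  have F: "?F \<in> borel_measurable ((\<omega> \<Otimes>\<^sub>M \<omega>) \<Otimes>\<^sub>M \<omega>)"
    by simp
  have "integrable trajectory (\<lambda>\<xi>. u (\<xi> i) * v (\<xi> (Suc m)))"
    by (intro L2_integrable_mult L2_coord u v)
  then have int: "integrable (kernel_prod ?P \<omega> (\<lambda>w. K (snd w))) ?F"
    using integrable_distr_eq[OF t F] by (simp add: law)
  have "(\<integral>\<xi>. u (\<xi> i) * v (\<xi> (Suc m)) \<partial>trajectory) = (\<integral>w. ?F w \<partial>kernel_prod ?P \<omega> (\<lambda>w. K (snd w)))"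
    using integral_distr[OF t F] by (simp add: law)
  also have "\<dots> = (\<integral>w. u (fst w) * kernel_op K v (snd w) \<partial>?P)"
    using PK.integral_kernel_prod[OF int] by (simp add: kernel_op_def)
  also have "\<dots> = (\<integral>\<xi>. u (\<xi> i) * kernel_op K v (\<xi> m) \<partial>trajectory)"
    by (subst integral_distr) simp_all
  finally show ?thesis .
qed

text \<open>Integrating out the last state shortens the lag by one and replaces \<open>v\<close> by
  \<open>kernel_op K v\<close>, hence an induction with \<open>v\<close> arbitrary.\<close>

lemma integral_coord_mult:
  assumes u: "u \<in> L2 \<omega>" and v: "v \<in> L2_0 \<omega>"
  shows "(\<integral>\<xi>. u (\<xi> i) * v (\<xi> (i + k)) \<partial>trajectory) = L2_inner \<omega> u ((kernel_op K ^^ k) v)"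
  using v
proof (induction k arbitrary: v)
  case 0
  then have "(\<lambda>x. u x * v x) \<in> borel_measurable \<omega>"
    using u by (intro borel_measurable_times L2_measurable) (auto intro: L2_0_imp_L2)
  from integral_coord[OF this] show ?case
    by (simp add: L2_inner_def)
next
  case (Suc k)
  have "(\<integral>\<xi>. u (\<xi> i) * v (\<xi> (i + Suc k)) \<partial>trajectory) = (\<integral>\<xi>. u (\<xi> i) * kernel_op K v (\<xi> (i + k)) \<partial>trajectory)"
    using integral_coord_step[OF u L2_0_imp_L2[OF Suc.prems], of i "i + k"] by simp
  also have "\<dots> = L2_inner \<omega> u ((kernel_op K ^^ k) (kernel_op K v))"
    by (rule Suc.IH[OF kernel_op_L2_0[OF Suc.prems]])
  finally show ?case
    by (simp add: funpow_swap1)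
qed

text \<open>Adding one state contributes its own variance and twice its covariances with the earlier
  states; by stationarity these depend only on the lag. The recursive form exhibits
  \<open>V t / t\<close> as a mean of increments that converge.\<close>

lemma variance_sum_Suc:
  assumes f: "f \<in> L2_0 \<omega>"
  defines "V \<equiv> \<lambda>t. prob_space.variance trajectory (\<lambda>\<xi>. \<Sum>s=1..t. f (\<xi> s))"
  shows "V (Suc t) = V t + (2 * (\<Sum>s<Suc t. autocov \<omega> K f s) - autocov \<omega> K f 0)"
proof -
  interpret T: prob_space trajectory by (rule prob_space_trajectory)
  have fL: "(\<lambda>\<xi>. f (\<xi> s)) \<in> L2 trajectory" for s
    by (intro L2_coord L2_0_imp_L2 f)
  have mean: "T.expectation (\<lambda>\<xi>. f (\<xi> s)) = 0" for s
    using integral_coord[OF L2_measurable[OF L2_0_imp_L2[OF f]]] f by (simp add: L2_0_def)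
  let ?S = "\<lambda>t \<xi>. \<Sum>s=1..t. f (\<xi> s)"
  have SL: "?S t \<in> L2 trajectory" for t
    by (rule L2_sum) (rule fL)
  have "T.expectation (?S t) = 0" for t
    by (subst Bochner_Integration.integral_sum) (auto intro: T.L2_integrable fL simp: mean)
  then have V: "V t = L2_inner trajectory (?S t) (?S t)" for t
    by (simp add: V_def L2_inner_def power2_eq_square)
  have fg: "L2_inner trajectory (\<lambda>\<xi>. f (\<xi> s)) (\<lambda>\<xi>. f (\<xi> (s + k))) = autocov \<omega> K f k" for s k
    using integral_coord_mult[OF L2_0_imp_L2[OF f] f] by (simp add: L2_inner_def autocov_def)
  let ?n = "\<lambda>\<xi>. f (\<xi> (Suc t))"
  have "L2_inner trajectory ?n (?S t) = (\<Sum>s=1..t. L2_inner trajectory ?n (\<lambda>\<xi>. f (\<xi> s)))"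
    by (rule L2_inner_sum_right) (rule fL)+
  also have "\<dots> = (\<Sum>s=1..t. autocov \<omega> K f (Suc t - s))"
  proof (rule sum.cong[OF refl])
    fix s assume "s \<in> {1..t}"
    then show "L2_inner trajectory ?n (\<lambda>\<xi>. f (\<xi> s)) = autocov \<omega> K f (Suc t - s)"
      using fg[of s "Suc t - s"] by (simp add: L2_inner_commute[of _ ?n])
  qed
  also have "\<dots> = (\<Sum>s=1..t. autocov \<omega> K f s)"
    by (rule sum.reindex_bij_witness[of _ "\<lambda>s. Suc t - s" "\<lambda>s. Suc t - s"]) auto
  \<comment> \<open>The cross terms have lags 1 to \<open>t\<close>; lag 0 is added and subtracted
    so that partial sums of the full series appear.\<close>
  also have "\<dots> = (\<Sum>s<Suc t. autocov \<omega> K f s) - autocov \<omega> K f 0"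
    by (simp only: sum.lessThan_Suc_shift) (simp add: sum.atLeast1_atMost_eq)
  finally have cross: "L2_inner trajectory ?n (?S t) = (\<Sum>s<Suc t. autocov \<omega> K f s) - autocov \<omega> K f 0" .
  have "V (Suc t) = L2_inner trajectory (\<lambda>\<xi>. ?S t \<xi> + ?n \<xi>) (\<lambda>\<xi>. ?S t \<xi> + ?n \<xi>)"
    by (simp add: V)
  also have "\<dots> = V t + 2 * L2_inner trajectory ?n (?S t) + L2_inner trajectory ?n ?n"
    using SL[of t] fL[of "Suc t"] L2_inner_commute[of trajectory "?S t" ?n]
    by (simp add: L2_inner_add_left L2_inner_add_right L2_add V)
  also have "L2_inner trajectory ?n ?n = autocov \<omega> K f 0"
    using fg[of "Suc t" 0] by simp
  finally show ?thesis
    unfolding cross by simp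
qed

end

section \<open>Cesaro means and existence of the asymptotic variance\<close>

lemma cesaro_mean_tendsto:
  fixes a :: "nat \<Rightarrow> real"
  assumes a: "a \<longlonglongrightarrow> l"
  shows "(\<lambda>t. (\<Sum>s<t. a s) / real t) \<longlonglongrightarrow> l"
proof (rule LIMSEQ_I)
  fix e :: real assume e: "0 < e"
  obtain N where N: "\<And>s. s \<ge> N \<Longrightarrow> \<bar>a s - l\<bar> < e / 2"
    using LIMSEQ_D[OF a, of "e / 2"] e by auto
  define C where "C = (\<Sum>s<N. \<bar>a s - l\<bar>)"
  have C: "0 \<le> C"
    by (simp add: C_def sum_nonneg)
  \<comment> \<open>From \<open>M\<close> on, the initial block contributes less than
    \<open>e / 2\<close> to the mean. The \<open>Suc\<close> in the threshold below keeps
    \<open>t\<close> positive for the division.\<close>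
  obtain M :: nat where M: "2 * C / e < real M"
    using reals_Archimedean2 by blast
  show "\<exists>n0. \<forall>t\<ge>n0. norm ((\<Sum>s<t. a s) / real t - l) < e"
  proof (intro exI allI impI)
    fix t assume t: "t \<ge> Suc (max N M)"
    have "(\<Sum>s<t. a s) / real t - l = (\<Sum>s<t. a s - l) / real t"
      using t by (simp add: sum_subtractf field_simps)
    moreover have "\<bar>\<Sum>s<t. a s - l\<bar> \<le> (\<Sum>s<t. \<bar>a s - l\<bar>)"
      by (rule sum_abs)
    moreover have "(\<Sum>s<t. \<bar>a s - l\<bar>) = C + (\<Sum>s=N..<t. \<bar>a s - l\<bar>)"
      unfolding C_def lessThan_atLeast0 using t by (intro sum.atLeastLessThan_concat[symmetric]) auto
    moreover have "(\<Sum>s=N..<t. \<bar>a s - l\<bar>) \<le> (\<Sum>s=N..<t. e / 2)"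
      by (intro sum_mono) (use N in \<open>auto intro: less_imp_le\<close>)
    moreover have "(\<Sum>s=N..<t. e / 2) \<le> real t * (e / 2)"
      using e by (simp add: mult_right_mono)
    moreover have "C < real t * (e / 2)"
    proof -
      have "2 * C / e < real t"
        using M t by simp
      with e show ?thesis by (simp add: field_simps)
    qed
    ultimately have "\<bar>\<Sum>s<t. a s - l\<bar> < real t * e"
      by linarith
    with t show "norm ((\<Sum>s<t. a s) / real t - l) < e"
      unfolding \<open>(\<Sum>s<t. a s) / real t - l = (\<Sum>s<t. a s - l) / real t\<close>
      by (simp add: abs_divide pos_divide_less_eq mult.commute)
  qed
qed

context contractive_chain
begin

lemma scaled_var_tendsto:
  assumes f: "f \<in> L2_0 \<omega>"
  shows "scaled_var \<omega> K f \<longlonglongrightarrow> 2 * suminf (autocov \<omega> K f) - (L2_norm \<omega> f)\<^sup>2"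
proof -
  let ?d = "\<lambda>t. 2 * (\<Sum>s<Suc t. autocov \<omega> K f s) - autocov \<omega> K f 0"
  have "prob_space.variance trajectory (\<lambda>\<xi>. \<Sum>s=1..t. f (\<xi> s)) = (\<Sum>s<t. ?d s)" for t
  proof (induction t)
    case 0
    then show ?case by simp
  next
    case (Suc t)
    show ?case
      unfolding variance_sum_Suc[OF f] Suc by simp
  qed
  then have "scaled_var \<omega> K f = (\<lambda>t. (\<Sum>s<t. ?d s) / real t)"
    by (simp add: scaled_var_def[abs_def])
  moreover have "?d \<longlonglongrightarrow> 2 * suminf (autocov \<omega> K f) - autocov \<omega> K f 0"
    by (intro tendsto_intros LIMSEQ_Suc summable_LIMSEQ summable_autocov f)
  ultimately show ?thesis
    by (simp only: cesaro_mean_tendsto) (simp add: cesaro_mean_tendsto autocov_def L2_norm_square)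
qed

lemma
  assumes f: "f \<in> L2_0 \<omega>"
  shows convergent_scaled_var: "convergent (scaled_var \<omega> K f)"
    and asymp_var_eq: "asymp_var \<omega> K f = 2 * suminf (autocov \<omega> K f) - (L2_norm \<omega> f)\<^sup>2"
  using scaled_var_tendsto[OF f] by (auto simp: asymp_var_def convergent_def limI)

end

section \<open>Mixtures and energies\<close>

text \<open>The mixture is the bind of the point measure with masses \<open>c\<close> and the family
  \<open>\<nu>\<close>, so the integral against a bind becomes the finite sum.\<close>

lemma nn_integral_finite_mixture:
  assumes I: "finite I" "I \<noteq> {}"
    and \<nu>: "\<And>i. i \<in> I \<Longrightarrow> \<nu> i \<in> space (subprob_algebra N)"
    and sets: "sets \<mu> = sets N"
    and \<mu>: "\<And>A. A \<in> sets N \<Longrightarrow> emeasure \<mu> A = (\<Sum>i\<in>I. c i * emeasure (\<nu> i) A)"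
    and g: "g \<in> borel_measurable N"
  shows "(\<integral>\<^sup>+x. g x \<partial>\<mu>) = (\<Sum>i\<in>I. c i * (\<integral>\<^sup>+x. g x \<partial>\<nu> i))"
proof -
  have m: "\<nu> \<in> measurable (point_measure I c) (subprob_algebra N)"
    using \<nu> by (auto intro!: measurableI simp: sets_point_measure space_point_measure)
  have "\<mu> = point_measure I c \<bind> \<nu>"
  proof (rule measure_eqI)
    show s: "sets \<mu> = sets (point_measure I c \<bind> \<nu>)"
      using \<nu> I by (subst sets_bind[where N = N]) (auto simp: sets space_point_measure space_subprob_algebra)
    fix A assume "A \<in> sets \<mu>"
    then have A: "A \<in> sets N" by (simp add: sets)
    have "emeasure (point_measure I c \<bind> \<nu>) A = (\<integral>\<^sup>+i. emeasure (\<nu> i) A \<partial>point_measure I c)"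
      using I by (intro emeasure_bind[OF _ m A]) (simp add: space_point_measure)
    also have "\<dots> = (\<Sum>i\<in>I. c i * emeasure (\<nu> i) A)"
      using I by (simp add: nn_integral_point_measure_finite)
    finally show "emeasure \<mu> A = emeasure (point_measure I c \<bind> \<nu>) A"
      using \<mu>[OF A] by simp
  qed
  then show ?thesis
    using I by (simp add: nn_integral_bind[OF g m] nn_integral_point_measure_finite)
qed

lemma integral_finite_mixture:
  fixes c :: "'i \<Rightarrow> real" and g :: "'t \<Rightarrow> real"
  assumes I: "finite I" "I \<noteq> {}"
    and \<nu>: "\<And>i. i \<in> I \<Longrightarrow> \<nu> i \<in> space (subprob_algebra N)"
    and sets: "sets \<mu> = sets N"
    and c: "\<And>i. i \<in> I \<Longrightarrow> 0 \<le> c i"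
    and \<mu>: "\<And>A. A \<in> sets N \<Longrightarrow> emeasure \<mu> A = (\<Sum>i\<in>I. ennreal (c i) * emeasure (\<nu> i) A)"
    and g: "\<And>i. i \<in> I \<Longrightarrow> integrable (\<nu> i) g"
  shows "(\<integral>x. g x \<partial>\<mu>) = (\<Sum>i\<in>I. c i * (\<integral>x. g x \<partial>\<nu> i))"
proof -
  from I obtain i where "i \<in> I" by auto
  with \<nu> g have gN[measurable]: "g \<in> borel_measurable N"
    using borel_measurable_integrable[OF g[OF \<open>i \<in> I\<close>]] \<nu>[OF \<open>i \<in> I\<close>]
    by (simp add: space_subprob_algebra cong: measurable_cong_sets)
  have nonneg: "has_bochner_integral \<mu> h (\<Sum>i\<in>I. c i * (\<integral>x. h x \<partial>\<nu> i))"
    if h: "\<And>i. i \<in> I \<Longrightarrow> integrable (\<nu> i) h" "\<And>x. 0 \<le> h x" and hN: "h \<in> borel_measurable N" for h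
  proof (rule has_bochner_integral_nn_integral)
    show "h \<in> borel_measurable \<mu>"
      using hN by (simp add: sets cong: measurable_cong_sets)
    have "(\<integral>\<^sup>+x. ennreal (h x) \<partial>\<mu>) = (\<Sum>i\<in>I. ennreal (c i) * (\<integral>\<^sup>+x. ennreal (h x) \<partial>\<nu> i))"
      using hN by (intro nn_integral_finite_mixture[OF I \<nu> sets \<mu>]) auto
    also have "\<dots> = (\<Sum>i\<in>I. ennreal (c i * (\<integral>x. h x \<partial>\<nu> i)))"
      using h c by (intro sum.cong refl) (simp add: nn_integral_eq_integral ennreal_mult')
    also have "\<dots> = ennreal (\<Sum>i\<in>I. c i * (\<integral>x. h x \<partial>\<nu> i))"
      using h c by (intro sum_ennreal mult_nonneg_nonneg integral_nonneg) auto
    finally show "(\<integral>\<^sup>+x. ennreal (h x) \<partial>\<mu>) = ennreal (\<Sum>i\<in>I. c i * (\<integral>x. h x \<partial>\<nu> i))" .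
  qed (use h c in \<open>auto intro!: sum_nonneg\<close>)
  have "has_bochner_integral \<mu> (\<lambda>x. max 0 (g x) - max 0 (- g x))
      ((\<Sum>i\<in>I. c i * (\<integral>x. max 0 (g x) \<partial>\<nu> i)) - (\<Sum>i\<in>I. c i * (\<integral>x. max 0 (- g x) \<partial>\<nu> i)))"
    using g by (intro has_bochner_integral_diff nonneg) auto
  also have "(\<lambda>x. max 0 (g x) - max 0 (- g x)) = g"
    by (auto simp: fun_eq_iff)
  also have "(\<Sum>i\<in>I. c i * (\<integral>x. max 0 (g x) \<partial>\<nu> i)) - (\<Sum>i\<in>I. c i * (\<integral>x. max 0 (- g x) \<partial>\<nu> i))
      = (\<Sum>i\<in>I. c i * (\<integral>x. g x \<partial>\<nu> i))"
    unfolding sum_subtractf[symmetric]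
  proof (intro sum.cong refl)
    fix i assume "i \<in> I"
    then have "(\<integral>x. max 0 (g x) \<partial>\<nu> i) - (\<integral>x. max 0 (- g x) \<partial>\<nu> i) = (\<integral>x. max 0 (g x) - max 0 (- g x) \<partial>\<nu> i)"
      using g by (intro Bochner_Integration.integral_diff[symmetric]) auto
    also have "\<dots> = (\<integral>x. g x \<partial>\<nu> i)"
      by (intro Bochner_Integration.integral_cong) auto
    finally show "c i * (\<integral>x. max 0 (g x) \<partial>\<nu> i) - c i * (\<integral>x. max 0 (- g x) \<partial>\<nu> i) = c i * (\<integral>x. g x \<partial>\<nu> i)"
      by (simp add: right_diff_distrib[symmetric])
  qed
  finally show ?thesis
    by (rule has_bochner_integral_integral_eq)
qed

context reversible_chain
begin

text \<open>The operator fixes constants, and by symmetry \<open><c, K u> = <c, u>\<close>; all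
  terms that involve the constant cancel.\<close>

lemma energy_diff_const:
  assumes u: "u \<in> L2 \<omega>"
  shows "energy \<omega> K (\<lambda>x. u x - c) = energy \<omega> K u"
proof -
  have K1: "L2_inner \<omega> w (kernel_op K (\<lambda>_. c)) = L2_inner \<omega> w (\<lambda>_. c)" for w
    unfolding L2_inner_def
    by (intro Bochner_Integration.integral_cong) (simp_all add: kernel_op_def prob_space.prob_space[OF prob_kernel])
  note c = L2_const[of c]
  have "L2_inner \<omega> (\<lambda>_. c) (kernel_op K u) = L2_inner \<omega> (\<lambda>_. c) u"
    using form_commute[OF c u] K1[of u] by (simp add: L2_inner_commute)
  then show ?thesis
    using u c by (simp add: energy_def L2_inner_diff_left L2_inner_diff_right form_diff_left form_diff_right
        L2_diff K1 L2_inner_commute[of \<omega> u "\<lambda>_. c"])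
qed

lemma dirichlet_form_eq_energy: "u \<in> L2 \<omega> \<Longrightarrow> dirichlet_form \<omega> K u = energy \<omega> K u"
  using energy_diff_const[of u "\<integral>z. u z \<partial>\<omega>"]
  by (simp add: dirichlet_form_def Let_def L2_norm_square energy_def)

text \<open>Constants do not change the energy, so ratio bounds on \<open>L2_0\<close> extend to \<open>L2\<close> with the
  squared norm replaced by the variance; a null denominator is harmless because then the energy
  vanishes as well.\<close>

lemma energy_bounds_variance:
  assumes u: "u \<in> L2 \<omega>"
    and bounds: "\<And>g. g \<in> L2_0 \<omega> \<Longrightarrow> \<not> (AE z in \<omega>. g z = 0) \<Longrightarrow>
      a \<le> dirichlet_form \<omega> K g / (L2_norm \<omega> g)\<^sup>2 \<and> dirichlet_form \<omega> K g / (L2_norm \<omega> g)\<^sup>2 \<le> b"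
  defines "v \<equiv> L2_inner \<omega> (\<lambda>x. u x - (\<integral>z. u z \<partial>\<omega>)) (\<lambda>x. u x - (\<integral>z. u z \<partial>\<omega>))"
  shows "a * v \<le> energy \<omega> K u" "energy \<omega> K u \<le> b * v"
proof -
  define h where "h = (\<lambda>x. u x - (\<integral>z. u z \<partial>\<omega>))"
  have h: "h \<in> L2_0 \<omega>"
    unfolding h_def by (rule L2_0_center[OF u])
  have e: "energy \<omega> K h = energy \<omega> K u"
    unfolding h_def by (rule energy_diff_const[OF u])
  have v: "v = L2_inner \<omega> h h"
    by (simp add: v_def h_def)
  have "a * v \<le> energy \<omega> K u \<and> energy \<omega> K u \<le> b * v"
  proof (cases "AE z in \<omega>. h z = 0")
    case True
    then have "AE z in \<omega>. h z * w z = 0" for w :: "'s \<Rightarrow> real"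
      by eventually_elim simp
    then have "L2_inner \<omega> h w = 0" for w
      unfolding L2_inner_def by (rule integral_eq_zero_AE)
    then show ?thesis
      unfolding e[symmetric] by (simp add: v energy_def)
  next
    case False
    have "L2_inner \<omega> h h \<noteq> 0"
    proof
      assume "L2_inner \<omega> h h = 0"
      then have "AE z in \<omega>. h z * h z = 0"
        unfolding L2_inner_def
        by (subst (asm) integral_nonneg_eq_0_iff_AE) (auto intro!: L2_integrable_mult L2_0_imp_L2 h)
      with False show False by simp
    qed
    then have "0 < L2_inner \<omega> h h"
      using L2_inner_nonneg[of \<omega> h] by simp
    with bounds[OF h False] show ?thesis
      by (simp add: dirichlet_form_eq_energy L2_0_imp_L2[OF h] L2_norm_square e v field_simps)
  qed
  then show "a * v \<le> energy \<omega> K u" "energy \<omega> K u \<le> b * v" by auto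
qed

end

text \<open>On a fibre the exact update draws afresh from the target, so its operator is the
  projection onto constants and the energy is a variance.\<close>

lemma energy_const_kernel:
  assumes "prob_space \<omega>" and u: "u \<in> L2 \<omega>"
  shows "energy \<omega> (\<lambda>_. \<omega>) u = L2_inner \<omega> (\<lambda>x. u x - (\<integral>z. u z \<partial>\<omega>)) (\<lambda>x. u x - (\<integral>z. u z \<partial>\<omega>))"
proof -
  interpret prob_space \<omega> by fact
  have "L2_inner \<omega> u (kernel_op (\<lambda>_. \<omega>) u) = (\<integral>z. u z \<partial>\<omega>) * (\<integral>z. u z \<partial>\<omega>)"
    by (simp add: L2_inner_def kernel_op_def)
  moreover have "L2_inner \<omega> u (\<lambda>_. c) = c * (\<integral>z. u z \<partial>\<omega>)" "L2_inner \<omega> (\<lambda>_. c) u = c * (\<integral>z. u z \<partial>\<omega>)"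
    "L2_inner \<omega> (\<lambda>_. c) (\<lambda>_. c) = c * c" for c
    by (simp_all add: L2_inner_def prob_space)
  ultimately show ?thesis
    using u L2_const by (simp add: energy_def L2_inner_diff_left L2_inner_diff_right L2_diff)
qed

section \<open>Random-scan Gibbs kernels\<close>

text \<open>Only the data common to both samplers. Keeping the fibre kernels out allows the exact
  sampler to be obtained as an instance of the hybrid one.\<close>

locale gibbs = prob_space \<pi> for \<pi> :: "(nat \<Rightarrow> 'a) measure" +
  fixes n :: nat and B :: "nat \<Rightarrow> 'a measure" and \<pi>c :: "nat \<Rightarrow> (nat \<Rightarrow> 'a) \<Rightarrow> 'a measure" and p :: "nat \<Rightarrow> real"
  assumes sets_Pi: "sets \<pi> = sets (prod_space n B)"
    and cond: "i \<in> {1..n} \<Longrightarrow> regular_cond_distr n B \<pi> i (\<pi>c i)"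
    and p_nonneg: "i \<in> {1..n} \<Longrightarrow> 0 \<le> p i"
    and p_sum: "(\<Sum>i=1..n. p i) = 1"
begin

abbreviation marg :: "nat \<Rightarrow> (nat \<Rightarrow> 'a) measure" where "marg i \<equiv> marginal_minus n B \<pi> i"
abbreviation fibre :: "nat \<Rightarrow> ((nat \<Rightarrow> 'a) \<times> 'a) measure" where "fibre i \<equiv> kernel_prod (marg i) (B i) (\<pi>c i)"

lemma space_Pi: "space \<pi> = space (prod_space n B)"
  by (rule sets_eq_imp_space_eq[OF sets_Pi])

lemma sets_marg[simp, measurable_cong]: "sets (marg i) = sets (prod_space_minus n B i)"
  by (simp add: marginal_minus_def)

lemma space_marg[simp]: "space (marg i) = space (prod_space_minus n B i)"
  by (simp add: marginal_minus_def)

lemma insert_minus: "i \<in> {1..n} \<Longrightarrow> {1..n} = ({1..n} - {i}) \<union> {i}"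
  by auto

lemma drop_coord_measurable[measurable]: "drop_coord n i \<in> measurable \<pi> (prod_space_minus n B i)"
  unfolding drop_coord_def[abs_def]
  by (subst measurable_cong_sets[OF sets_Pi refl]) (rule measurable_restrict_subset, auto)

lemma coord_measurable: "i \<in> {1..n} \<Longrightarrow> (\<lambda>x. x i) \<in> measurable \<pi> (B i)"
  by (subst measurable_cong_sets[OF sets_Pi refl]) (rule measurable_component_singleton)

lemma prob_space_marg: "prob_space (marg i)"
  unfolding marginal_minus_def by (rule prob_space_distr[OF drop_coord_measurable])

lemma prob_kernel_cond:
  assumes "i \<in> {1..n}"
  shows "prob_kernel (marg i) (B i) (\<pi>c i)"
  using cond[OF assms] prob_space_marg[of i]
  by (auto simp: prob_kernel_def prob_kernel_axioms_def regular_cond_distr_def cong: measurable_cong_sets)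

lemma update_measurable:
  assumes i: "i \<in> {1..n}"
  shows "(\<lambda>w. (fst w)(i := snd w)) \<in> measurable (prod_space_minus n B i \<Otimes>\<^sub>M B i) \<pi>"
  by (subst measurable_cong_sets[OF refl sets_Pi])
     (rule measurable_fun_upd[OF insert_minus[OF i]], auto)

lemma update_measurable':
  assumes i: "i \<in> {1..n}"
  shows "(\<lambda>w. (fst w)(i := snd w)) \<in> measurable (\<pi> \<Otimes>\<^sub>M B i) \<pi>"
proof -
  have "fst \<in> measurable (\<pi> \<Otimes>\<^sub>M B i) (prod_space n B)"
    using measurable_fst[of \<pi> "B i"] sets_Pi by (simp cong: measurable_cong_sets)
  then show ?thesis
    by (subst measurable_cong_sets[OF refl sets_Pi])
       (rule measurable_fun_upd[where J = "{1..n}"], use i in auto)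
qed

lemma drop_coord_update: "y \<in> space (prod_space_minus n B i) \<Longrightarrow> drop_coord n i (y(i := z)) = y"
  by (auto simp: drop_coord_def space_PiM PiE_def extensional_def restrict_def fun_eq_iff)

lemma update_drop_coord:
  "x \<in> space \<pi> \<Longrightarrow> (drop_coord n i x)(i := x i) = x"
  by (auto simp: drop_coord_def space_Pi space_PiM PiE_def extensional_def restrict_def fun_eq_iff)

lemma drop_coord_space: "x \<in> space \<pi> \<Longrightarrow> drop_coord n i x \<in> space (prod_space_minus n B i)"
  using measurable_space[OF drop_coord_measurable] .

lemma coord_space: "x \<in> space \<pi> \<Longrightarrow> i \<in> {1..n} \<Longrightarrow> x i \<in> space (B i)"
  using measurable_space[OF coord_measurable] .

section \<open>Disintegration of the target along one coordinate\<close>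

lemma split_measurable:
  "i \<in> {1..n} \<Longrightarrow> (\<lambda>x. (drop_coord n i x, x i)) \<in> measurable \<pi> (prod_space_minus n B i \<Otimes>\<^sub>M B i)"
  by (intro measurable_Pair drop_coord_measurable coord_measurable)

text \<open>The definition of a regular conditional distribution is precisely this equality on
  rectangles, which determine the measure.\<close>

lemma distr_split:
  assumes i: "i \<in> {1..n}"
  shows "distr \<pi> (prod_space_minus n B i \<Otimes>\<^sub>M B i) (\<lambda>x. (drop_coord n i x, x i)) = fibre i"
    (is "distr \<pi> ?S ?\<phi> = _")
proof (rule measure_eqI_rectangles[where A = "prod_space_minus n B i" and B = "B i"])
  interpret C: prob_kernel "marg i" "B i" "\<pi>c i" by (rule prob_kernel_cond[OF i])
  show "finite_measure (distr \<pi> ?S ?\<phi>)"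
    by (rule finite_measure_distr[OF split_measurable[OF i]])
  show "sets (fibre i) = sets ?S"
    unfolding C.sets_kernel_prod by (rule sets_pair_measure_cong) simp_all
  fix a b assume a: "a \<in> sets (prod_space_minus n B i)" and b: "b \<in> sets (B i)"
  have "emeasure (distr \<pi> ?S ?\<phi>) (a \<times> b) = emeasure \<pi> (?\<phi> -` (a \<times> b) \<inter> space \<pi>)"
    using a b by (intro emeasure_distr split_measurable i) simp
  also have "?\<phi> -` (a \<times> b) \<inter> space \<pi> = {x \<in> space \<pi>. drop_coord n i x \<in> a \<and> x i \<in> b}"
    by auto
  also have "emeasure \<pi> \<dots> = emeasure (fibre i) (a \<times> b)"
    using cond[OF i] a b by (simp add: regular_cond_distr_def C.emeasure_kernel_prod_Times)
  finally show "emeasure (distr \<pi> ?S ?\<phi>) (a \<times> b) = emeasure (fibre i) (a \<times> b)" .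
qed simp

lemma update_measurable_borel:
  "i \<in> {1..n} \<Longrightarrow> h \<in> borel_measurable \<pi> \<Longrightarrow>
    (\<lambda>w. h ((fst w)(i := snd w))) \<in> borel_measurable (prod_space_minus n B i \<Otimes>\<^sub>M B i)"
  by (rule measurable_compose[OF update_measurable])

lemma nn_integral_disintegrate:
  assumes i: "i \<in> {1..n}" and h: "h \<in> borel_measurable \<pi>"
  shows "(\<integral>\<^sup>+x. h x \<partial>\<pi>) = (\<integral>\<^sup>+y. \<integral>\<^sup>+z. h (y(i := z)) \<partial>\<pi>c i y \<partial>marg i)"
proof -
  interpret C: prob_kernel "marg i" "B i" "\<pi>c i" by (rule prob_kernel_cond[OF i])
  have hm: "(\<lambda>w. h ((fst w)(i := snd w))) \<in> borel_measurable (marg i \<Otimes>\<^sub>M B i)"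
    using update_measurable_borel[OF i h] by (simp cong: measurable_cong_sets sets_pair_measure_cong)
  \<comment> \<open>A point is reassembled from its two parts so that the integrand factors through
    the splitting map.\<close>
  have "(\<integral>\<^sup>+x. h x \<partial>\<pi>) = (\<integral>\<^sup>+x. h ((drop_coord n i x)(i := x i)) \<partial>\<pi>)"
    by (intro nn_integral_cong) (simp add: update_drop_coord)
  also have "\<dots> = (\<integral>\<^sup>+w. h ((fst w)(i := snd w)) \<partial>fibre i)"
    unfolding distr_split[OF i, symmetric]
    using update_measurable_borel[OF i h] by (subst nn_integral_distr[OF split_measurable[OF i]]) simp_all
  also have "\<dots> = (\<integral>\<^sup>+y. \<integral>\<^sup>+z. h (y(i := z)) \<partial>\<pi>c i y \<partial>marg i)"
    by (subst C.nn_integral_kernel_prod[OF hm]) simp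
  finally show ?thesis .
qed

lemma
  fixes h :: "(nat \<Rightarrow> 'a) \<Rightarrow> real"
  assumes i: "i \<in> {1..n}" and h: "integrable \<pi> h"
  shows AE_integrable_disintegrate: "AE y in marg i. integrable (\<pi>c i y) (\<lambda>z. h (y(i := z)))"
    and integrable_disintegrate: "integrable (marg i) (\<lambda>y. \<integral>z. h (y(i := z)) \<partial>\<pi>c i y)"
    and integral_disintegrate: "(\<integral>x. h x \<partial>\<pi>) = (\<integral>y. \<integral>z. h (y(i := z)) \<partial>\<pi>c i y \<partial>marg i)"
proof -
  interpret C: prob_kernel "marg i" "B i" "\<pi>c i" by (rule prob_kernel_cond[OF i])
  let ?h = "\<lambda>w. h ((fst w)(i := snd w))"
  have hm: "h \<in> borel_measurable \<pi>"
    using h by simp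
  have "integrable \<pi> (\<lambda>x. ?h (drop_coord n i x, x i))"
    using h by (subst Bochner_Integration.integrable_cong[OF refl, of _ _ h]) (simp_all add: update_drop_coord)
  then have int: "integrable (fibre i) ?h"
    unfolding distr_split[OF i, symmetric]
    by (subst integrable_distr_eq[OF split_measurable[OF i] update_measurable_borel[OF i hm]])
  show "AE y in marg i. integrable (\<pi>c i y) (\<lambda>z. h (y(i := z)))"
    using C.AE_integrable_kernel[OF int] by simp
  show "integrable (marg i) (\<lambda>y. \<integral>z. h (y(i := z)) \<partial>\<pi>c i y)"
    using C.integrable_kernel_prod[OF int] by simp
  have "(\<integral>x. h x \<partial>\<pi>) = (\<integral>x. ?h (drop_coord n i x, x i) \<partial>\<pi>)"
    by (intro Bochner_Integration.integral_cong) (simp_all add: update_drop_coord)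
  also have "\<dots> = (\<integral>w. ?h w \<partial>fibre i)"
    unfolding distr_split[OF i, symmetric]
    by (subst integral_distr[OF split_measurable[OF i] update_measurable_borel[OF i hm]]) simp
  also have "\<dots> = (\<integral>y. \<integral>z. h (y(i := z)) \<partial>\<pi>c i y \<partial>marg i)"
    using C.integral_kernel_prod[OF int] by simp
  finally show "(\<integral>x. h x \<partial>\<pi>) = (\<integral>y. \<integral>z. h (y(i := z)) \<partial>\<pi>c i y \<partial>marg i)" .
qed

lemma AE_L2_fibre:
  assumes i: "i \<in> {1..n}" and g: "g \<in> L2 \<pi>"
  shows "AE y in marg i. (\<lambda>z. g (y(i := z))) \<in> L2 (\<pi>c i y)"
proof -
  interpret C: prob_kernel "marg i" "B i" "\<pi>c i" by (rule prob_kernel_cond[OF i])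
  have hm: "(\<lambda>w. g ((fst w)(i := snd w))) \<in> borel_measurable (marg i \<Otimes>\<^sub>M B i)"
    using update_measurable_borel[OF i L2_measurable[OF g]]
    by (simp cong: measurable_cong_sets sets_pair_measure_cong)
  show ?thesis
    using AE_integrable_disintegrate[OF i L2_integrable_square[OF g]] AE_space
  proof eventually_elim
    case (elim y)
    then show ?case
      using C.measurable_section[OF hm, of y] by (simp add: L2_def)
  qed
qed

end

section \<open>Coordinate updates and reversibility of the random scan\<close>

locale hybrid_gibbs = gibbs +
  fixes Q :: "nat \<Rightarrow> (nat \<Rightarrow> 'a) \<Rightarrow> 'a \<Rightarrow> 'a measure"
  assumes Q_kernel: "i \<in> {1..n} \<Longrightarrow> y \<in> space (prod_space_minus n B i) \<Longrightarrow> markov_kernel (B i) (Q i y)"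
    and Q_reversible: "i \<in> {1..n} \<Longrightarrow> y \<in> space (prod_space_minus n B i) \<Longrightarrow> reversible_kernel (\<pi>c i y) (Q i y)"
    and Q_measurable: "i \<in> {1..n} \<Longrightarrow> A \<in> sets (B i) \<Longrightarrow>
      (\<lambda>x. measure (Q i (drop_coord n i x) (x i)) A) \<in> borel_measurable (prod_space n B)"
begin

abbreviation scan :: "(nat \<Rightarrow> 'a) \<Rightarrow> (nat \<Rightarrow> 'a) measure" where "scan \<equiv> hybrid_gibbs_kernel n B p Q"

text \<open>The \<open>i\<close>th summand as a kernel in its own right. It is reversible for
  \<open>\<pi>\<close>, so the theory on \<open>L2\<close> applies to each summand before they are
  mixed.\<close>

definition component :: "nat \<Rightarrow> (nat \<Rightarrow> 'a) \<Rightarrow> (nat \<Rightarrow> 'a) measure" where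
  "component i x = distr (Q i (drop_coord n i x) (x i)) \<pi> (\<lambda>z. x(i := z))"

lemma
  assumes "i \<in> {1..n}" "y \<in> space (prod_space_minus n B i)" "z \<in> space (B i)"
  shows prob_space_Q: "prob_space (Q i y z)" and sets_Q: "sets (Q i y z) = sets (B i)"
  using measurable_space[OF Q_kernel[OF assms(1,2), unfolded markov_kernel_def] assms(3)]
  by (simp_all add: space_prob_algebra)

text \<open>Measurability is given one set at a time. The sigma-algebra \<open>B i\<close> is closed
  under intersections and so is its own generator, which turns this into measurability as a map into
  probability measures.\<close>

lemma redraw_measurable:
  assumes i: "i \<in> {1..n}"
  shows "(\<lambda>x. Q i (drop_coord n i x) (x i)) \<in> measurable \<pi> (prob_algebra (B i))"
proof (rule measurable_prob_algebra_generated[where \<Omega> = "space (B i)" and G = "sets (B i)"])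
  show "sets (B i) = sigma_sets (space (B i)) (sets (B i))"
    by (rule sets.sigma_sets_eq[symmetric])
  show "Int_stable (sets (B i))"
    by (auto simp: Int_stable_def)
  show "sets (B i) \<subseteq> Pow (space (B i))"
    by (rule sets.space_closed)
  fix x assume "x \<in> space \<pi>"
  with i have y: "drop_coord n i x \<in> space (prod_space_minus n B i)" and z: "x i \<in> space (B i)"
    by (blast intro: drop_coord_space coord_space)+
  show "prob_space (Q i (drop_coord n i x) (x i))"
    by (rule prob_space_Q[OF i y z])
  show "sets (Q i (drop_coord n i x) (x i)) = sets (B i)"
    by (rule sets_Q[OF i y z])
next
  fix A assume A: "A \<in> sets (B i)"
  have "(\<lambda>x. ennreal (measure (Q i (drop_coord n i x) (x i)) A)) \<in> borel_measurable \<pi>"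
    using Q_measurable[OF i A] by (subst measurable_cong_sets[OF sets_Pi refl]) simp
  also have "?this \<longleftrightarrow> (\<lambda>x. emeasure (Q i (drop_coord n i x) (x i)) A) \<in> borel_measurable \<pi>"
  proof (rule measurable_cong)
    fix x assume "x \<in> space \<pi>"
    with i have "prob_space (Q i (drop_coord n i x) (x i))"
      by (intro prob_space_Q drop_coord_space coord_space)
    then show "ennreal (measure (Q i (drop_coord n i x) (x i)) A) = emeasure (Q i (drop_coord n i x) (x i)) A"
      by (simp add: finite_measure.emeasure_eq_measure prob_space.finite_measure)
  qed
  finally show "(\<lambda>x. emeasure (Q i (drop_coord n i x) (x i)) A) \<in> borel_measurable \<pi>" .
qed

lemma component_measurable:
  assumes i: "i \<in> {1..n}"
  shows "component i \<in> measurable \<pi> (prob_algebra \<pi>)"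
  unfolding component_def[abs_def]
  by (rule measurable_distr_prob_space2[OF redraw_measurable[OF i]])
     (use update_measurable'[OF i] in \<open>simp add: split_beta'\<close>)

lemma update_section_measurable:
  assumes i: "i \<in> {1..n}" and y: "y \<in> space (prod_space_minus n B i)"
  shows "(\<lambda>z. y(i := z)) \<in> measurable (B i) \<pi>"
  using measurable_compose[OF measurable_Pair1'[OF y] update_measurable[OF i]] by simp

text \<open>The old \<open>i\<close>th coordinate is overwritten, so the update never leaves the
  fibre over \<open>y\<close> and depends on \<open>z\<close> only through
  \<open>Q i y z\<close>.\<close>

lemma component_update:
  assumes i: "i \<in> {1..n}" and y: "y \<in> space (prod_space_minus n B i)"
  shows "component i (y(i := z)) = distr (Q i y z) \<pi> (\<lambda>z. y(i := z))"
  using y by (simp add: component_def drop_coord_update)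

lemma kernel_op_component_update:
  assumes i: "i \<in> {1..n}" and y: "y \<in> space (prod_space_minus n B i)" and z: "z \<in> space (B i)"
    and g: "g \<in> borel_measurable \<pi>"
  shows "kernel_op (component i) g (y(i := z)) = kernel_op (Q i y) (\<lambda>z. g (y(i := z))) z"
  unfolding kernel_op_def component_update[OF i y]
  by (rule integral_distr[OF _ g])
     (simp add: update_section_measurable[OF i y] measurable_cong_sets[OF sets_Q[OF i y z] refl])

lemma reversible_fibre:
  assumes i: "i \<in> {1..n}" and y: "y \<in> space (prod_space_minus n B i)"
  shows "reversible_chain (\<pi>c i y) (Q i y)"
proof -
  interpret C: prob_kernel "marg i" "B i" "\<pi>c i" by (rule prob_kernel_cond[OF i])
  have s: "sets (\<pi>c i y) = sets (B i)"
    using y by (intro C.sets_kernel_eq) simp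
  have eq: "prob_algebra (\<pi>c i y) = prob_algebra (B i)"
    unfolding prob_algebra_def by (simp add: subprob_algebra_cong[OF s])
  have "markov_kernel (\<pi>c i y) (Q i y)"
    using Q_kernel[OF i y] unfolding markov_kernel_def eq by (simp add: measurable_cong_sets[OF s refl])
  with Q_reversible[OF i y] C.prob_kernel[of y] y show ?thesis
    by (simp add: reversible_chain_def reversible_chain_axioms_def)
qed

text \<open>Disintegration splits the flow between two sets into flows between their sections on
  each fibre, where reversibility of \<open>Q i y\<close> applies.\<close>

lemma reversible_component:
  assumes i: "i \<in> {1..n}"
  shows "reversible_kernel \<pi> (component i)"
  unfolding reversible_kernel_def
proof (intro ballI)
  interpret C: prob_kernel "marg i" "B i" "\<pi>c i" by (rule prob_kernel_cond[OF i])
  \<comment> \<open>The flow from \<open>A\<close> to \<open>D\<close> inside the fibre over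
    \<open>y\<close>.\<close>
  define R where "R A D y = (\<integral>\<^sup>+z\<in>{z \<in> space (B i). y(i := z) \<in> A}.
      emeasure (Q i y z) {z \<in> space (B i). y(i := z) \<in> D} \<partial>\<pi>c i y)" for A D y
  have eq: "(\<integral>\<^sup>+x\<in>A. emeasure (component i x) D \<partial>\<pi>) = (\<integral>\<^sup>+y. R A D y \<partial>marg i)"
    if A: "A \<in> sets \<pi>" and D: "D \<in> sets \<pi>" for A D
  proof -
    have "(\<lambda>x. emeasure (component i x) D) \<in> borel_measurable \<pi>"
      by (rule measurable_emeasure_kernel[OF measurable_prob_algebraD[OF component_measurable[OF i]] D])
    then have "(\<lambda>x. emeasure (component i x) D * indicator A x) \<in> borel_measurable \<pi>"
      using A by simp
    then have "(\<integral>\<^sup>+x\<in>A. emeasure (component i x) D \<partial>\<pi>) =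
        (\<integral>\<^sup>+y. \<integral>\<^sup>+z. emeasure (component i (y(i := z))) D * indicator A (y(i := z)) \<partial>\<pi>c i y \<partial>marg i)"
      by (rule nn_integral_disintegrate[OF i])
    also have "\<dots> = (\<integral>\<^sup>+y. R A D y \<partial>marg i)"
      unfolding R_def
    proof (intro nn_integral_cong)
      fix y z assume "y \<in> space (marg i)" and z': "z \<in> space (\<pi>c i y)"
      then have y: "y \<in> space (prod_space_minus n B i)" and z: "z \<in> space (B i)"
        using C.space_kernel_eq[of y] by auto
      have "emeasure (component i (y(i := z))) D = emeasure (Q i y z) ((\<lambda>z. y(i := z)) -` D \<inter> space (Q i y z))"
        unfolding component_update[OF i y]
        by (rule emeasure_distr[OF _ D])
           (simp add: update_section_measurable[OF i y] measurable_cong_sets[OF sets_Q[OF i y z] refl])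
      also have "(\<lambda>z. y(i := z)) -` D \<inter> space (Q i y z) = {z \<in> space (B i). y(i := z) \<in> D}"
        using sets_eq_imp_space_eq[OF sets_Q[OF i y z]] by auto
      moreover have "indicator A (y(i := z)) = (indicator {z \<in> space (B i). y(i := z) \<in> A} z :: ennreal)"
        using z by (simp add: indicator_def)
      ultimately show "emeasure (component i (y(i := z))) D * indicator A (y(i := z)) =
          emeasure (Q i y z) {z \<in> space (B i). y(i := z) \<in> D} * indicator {z \<in> space (B i). y(i := z) \<in> A} z"
        by (simp only:)
    qed
    finally show ?thesis .
  qed
  fix A D assume AD: "A \<in> sets \<pi>" "D \<in> sets \<pi>"
  have "R A D y = R D A y" if "y \<in> space (marg i)" for y
  proof -
    have y: "y \<in> space (prod_space_minus n B i)"
      using that by simp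
    have "{z \<in> space (B i). y(i := z) \<in> E} \<in> sets (\<pi>c i y)" if "E \<in> sets \<pi>" for E
      using measurable_sets[OF update_section_measurable[OF i y] that] C.sets_kernel_eq[of y] y
      by (simp add: vimage_def Int_def conj_commute)
    then show ?thesis
      using Q_reversible[OF i y] AD unfolding R_def reversible_kernel_def by blast
  qed
  then show "(\<integral>\<^sup>+x\<in>A. emeasure (component i x) D \<partial>\<pi>) = (\<integral>\<^sup>+x\<in>D. emeasure (component i x) A \<partial>\<pi>)"
    unfolding eq[OF AD] eq[OF AD(2,1)] by (rule nn_integral_cong)
qed

lemma reversible_chain_component: "i \<in> {1..n} \<Longrightarrow> reversible_chain \<pi> (component i)"
  using component_measurable reversible_component prob_space_axioms
  by (simp add: reversible_chain_def reversible_chain_axioms_def markov_kernel_def)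

lemma sets_scan: "sets (scan x) = sets \<pi>"
  unfolding hybrid_gibbs_kernel_def random_scan_def
  by (simp add: sets_measure_of[OF sets.space_closed] sets.sigma_sets_eq sets_Pi)

text \<open>\<open>measure_of\<close> returns the prescribed set function only if it is countably
  additive; a weighted finite sum of measures is.\<close>

lemma emeasure_scan:
  assumes A: "A \<in> sets \<pi>"
  shows "emeasure (scan x) A = (\<Sum>i=1..n. ennreal (p i) * emeasure (component i x) A)"
proof -
  let ?\<nu> = "\<lambda>i. distr (Q i (drop_coord n i x) (x i)) (prod_space n B) (\<lambda>z. x(i := z))"
  let ?\<mu> = "\<lambda>A. \<Sum>i=1..n. ennreal (p i) * emeasure (?\<nu> i) A"
  have "countably_additive (sets (prod_space n B)) ?\<mu>"
  proof (rule countably_additiveI)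
    fix D :: "nat \<Rightarrow> (nat \<Rightarrow> 'a) set"
    assume D: "range D \<subseteq> sets (prod_space n B)" "disjoint_family D"
    have "(\<Sum>j. ?\<mu> (D j)) = (\<Sum>i=1..n. \<Sum>j. ennreal (p i) * emeasure (?\<nu> i) (D j))"
      by (rule suminf_sum) simp
    also have "\<dots> = ?\<mu> (\<Union>j. D j)"
      using D by (simp add: suminf_emeasure)
    finally show "(\<Sum>j. ?\<mu> (D j)) = ?\<mu> (\<Union>j. D j)" .
  qed
  then have "emeasure (scan x) A = ?\<mu> A"
    unfolding hybrid_gibbs_kernel_def random_scan_def
    using A by (intro emeasure_measure_of_sigma sets.sigma_algebra_axioms)
      (auto simp: positive_def sets_Pi)
  also have "\<dots> = (\<Sum>i=1..n. ennreal (p i) * emeasure (component i x) A)"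
    unfolding component_def by (intro sum.cong refl arg_cong2[where f = "(*)"] arg_cong2[where f = emeasure] distr_cong)
      (simp_all add: sets_Pi)
  finally show ?thesis .
qed

lemma component_space:
  assumes "x \<in> space \<pi>" "i \<in> {1..n}"
  shows "sets (component i x) = sets \<pi>" "prob_space (component i x)"
  using measurable_space[OF component_measurable[OF assms(2)] assms(1)] by (simp_all add: space_prob_algebra)

lemma scan_measurable: "scan \<in> measurable \<pi> (prob_algebra \<pi>)"
proof (rule measurable_prob_algebra_generated[where \<Omega> = "space \<pi>" and G = "sets \<pi>"])
  show "sets \<pi> = sigma_sets (space \<pi>) (sets \<pi>)"
    by (rule sets.sigma_sets_eq[symmetric])
  show "Int_stable (sets \<pi>)"
    by (auto simp: Int_stable_def)
  show "sets \<pi> \<subseteq> Pow (space \<pi>)"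
    by (rule sets.space_closed)
  show "sets (scan x) = sets \<pi>" for x
    by (rule sets_scan)
  show "prob_space (scan x)" if x: "x \<in> space \<pi>" for x
  proof (rule prob_spaceI)
    have "emeasure (scan x) (space (scan x)) = (\<Sum>i=1..n. ennreal (p i) * emeasure (component i x) (space \<pi>))"
      unfolding sets_eq_imp_space_eq[OF sets_scan] by (rule emeasure_scan) simp
    also have "\<dots> = (\<Sum>i=1..n. ennreal (p i))"
    proof (rule sum.cong[OF refl])
      fix i assume i: "i \<in> {1..n}"
      show "ennreal (p i) * emeasure (component i x) (space \<pi>) = ennreal (p i)"
        using prob_space.emeasure_space_1[OF component_space(2)[OF x i]]
        by (simp add: sets_eq_imp_space_eq[OF component_space(1)[OF x i]])
    qed
    also have "\<dots> = ennreal (\<Sum>i=1..n. p i)"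
      using p_nonneg by (rule sum_ennreal)
    also have "\<dots> = 1"
      unfolding p_sum by simp
    finally show "emeasure (scan x) (space (scan x)) = 1" .
  qed
  fix A assume A: "A \<in> sets \<pi>"
  then show "(\<lambda>x. emeasure (scan x) A) \<in> borel_measurable \<pi>"
    unfolding emeasure_scan[OF A]
    by (intro borel_measurable_sum borel_measurable_times_ennreal borel_measurable_const
        measurable_emeasure_kernel[OF measurable_prob_algebraD[OF component_measurable]])
qed

lemma reversible_scan: "reversible_kernel \<pi> scan"
  unfolding reversible_kernel_def
proof (intro ballI)
  have eq: "(\<integral>\<^sup>+x\<in>A. emeasure (scan x) D \<partial>\<pi>)
      = (\<Sum>i=1..n. ennreal (p i) * (\<integral>\<^sup>+x\<in>A. emeasure (component i x) D \<partial>\<pi>))"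
    if A: "A \<in> sets \<pi>" and D: "D \<in> sets \<pi>" for A D
  proof -
    have m: "(\<lambda>x. emeasure (component i x) D * indicator A x) \<in> borel_measurable \<pi>" if "i \<in> {1..n}" for i
      using measurable_emeasure_kernel[OF measurable_prob_algebraD[OF component_measurable[OF that]] D] A
      by simp
    have "(\<integral>\<^sup>+x\<in>A. emeasure (scan x) D \<partial>\<pi>)
        = (\<integral>\<^sup>+x. (\<Sum>i=1..n. ennreal (p i) * (emeasure (component i x) D * indicator A x)) \<partial>\<pi>)"
      unfolding emeasure_scan[OF D] by (simp add: sum_distrib_right mult.assoc)
    also have "\<dots> = (\<Sum>i=1..n. \<integral>\<^sup>+x. ennreal (p i) * (emeasure (component i x) D * indicator A x) \<partial>\<pi>)"
      by (intro nn_integral_sum borel_measurable_times_ennreal[OF borel_measurable_const m])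
    also have "\<dots> = (\<Sum>i=1..n. ennreal (p i) * (\<integral>\<^sup>+x\<in>A. emeasure (component i x) D \<partial>\<pi>))"
      by (intro sum.cong refl nn_integral_cmult m)
    finally show ?thesis .
  qed
  fix A D assume AD: "A \<in> sets \<pi>" "D \<in> sets \<pi>"
  show "(\<integral>\<^sup>+x\<in>A. emeasure (scan x) D \<partial>\<pi>) = (\<integral>\<^sup>+x\<in>D. emeasure (scan x) A \<partial>\<pi>)"
    unfolding eq[OF AD] eq[OF AD(2,1)]
    using reversible_component AD by (intro sum.cong refl) (simp add: reversible_kernel_def)
qed

section \<open>Forms and energies as averages over fibres\<close>

sublocale scan: reversible_chain \<pi> scan
  using scan_measurable reversible_scan
  by unfold_locales (simp_all add: markov_kernel_def)

text \<open>The operator of a mixture is the mixture of the operators wherever \<open>g\<close> is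
  integrable under every single update, which holds almost everywhere and is enough inside an inner
  product.\<close>

lemma scan_form:
  assumes g: "g \<in> L2 \<pi>"
  shows "L2_inner \<pi> g (kernel_op scan g) = (\<Sum>i=1..n. p i * L2_inner \<pi> g (kernel_op (component i) g))"
proof -
  \<comment> \<open>Weights with sum 1 rule out an empty index set.\<close>
  have n: "{1..n} \<noteq> {}"
    using p_sum by (cases "n = 0") auto
  have opL2: "kernel_op (component i) g \<in> L2 \<pi>" if "i \<in> {1..n}" for i
    using reversible_chain.kernel_op_L2[OF reversible_chain_component[OF that] g] .
  \<comment> \<open>Finitely many updates allow a common exceptional null set.\<close>
  have "AE x in \<pi>. \<forall>i\<in>{1..n}. g \<in> L2 (component i x)"
    using reversible_chain.AE_L2_kernel[OF reversible_chain_component g] by (intro AE_finite_allI) auto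
  with AE_space have "AE x in \<pi>. kernel_op scan g x = (\<Sum>i=1..n. p i * kernel_op (component i) g x)"
  proof eventually_elim
    case (elim x)
    show ?case
      unfolding kernel_op_def
    proof (rule integral_finite_mixture[where N = \<pi>])
      fix i assume i: "i \<in> {1..n}"
      then show "component i x \<in> space (subprob_algebra \<pi>)"
        using component_space[OF elim(1)] by (simp add: space_subprob_algebra prob_space_imp_subprob_space)
      show "integrable (component i x) g"
        using elim(2) i component_space(2)[OF elim(1) i] prob_space.L2_integrable by blast
    qed (use n emeasure_scan p_nonneg sets_scan in auto)
  qed
  then have "AE x in \<pi>. g x * kernel_op scan g x = (\<Sum>i=1..n. p i * (g x * kernel_op (component i) g x))"
    by eventually_elim (simp add: sum_distrib_left mult_ac)
  then have "L2_inner \<pi> g (kernel_op scan g) = (\<integral>x. (\<Sum>i=1..n. p i * (g x * kernel_op (component i) g x)) \<partial>\<pi>)"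
    unfolding L2_inner_def
    using L2_measurable[OF g] L2_measurable[OF opL2] scan.kernel_op_L2[OF g, THEN L2_measurable]
    by (intro integral_cong_AE borel_measurable_sum borel_measurable_times) auto
  also have "\<dots> = (\<Sum>i=1..n. p i * L2_inner \<pi> g (kernel_op (component i) g))"
    using L2_integrable_mult[OF g opL2]
    by (subst Bochner_Integration.integral_sum) (auto simp: L2_inner_def)
  finally show ?thesis .
qed

text \<open>Along a fibre the \<open>i\<close>th update acts on the section of \<open>g\<close> as
  \<open>Q i y\<close>, so disintegrating the product of \<open>g\<close> and its image yields the
  fibre forms.\<close>

lemma
  assumes i: "i \<in> {1..n}" and g: "g \<in> L2 \<pi>"
  defines "e \<equiv> \<lambda>y. L2_inner (\<pi>c i y) (\<lambda>z. g (y(i := z))) (kernel_op (Q i y) (\<lambda>z. g (y(i := z))))"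
  shows integrable_component_form: "integrable (marg i) e"
    and component_form: "L2_inner \<pi> g (kernel_op (component i) g) = (\<integral>y. e y \<partial>marg i)"
proof -
  interpret C: prob_kernel "marg i" "B i" "\<pi>c i" by (rule prob_kernel_cond[OF i])
  have "kernel_op (component i) g \<in> L2 \<pi>"
    using reversible_chain.kernel_op_L2[OF reversible_chain_component[OF i] g] .
  then have int: "integrable \<pi> (\<lambda>x. g x * kernel_op (component i) g x)"
    by (rule L2_integrable_mult[OF g])
  have e: "(\<integral>z. g (y(i := z)) * kernel_op (component i) g (y(i := z)) \<partial>\<pi>c i y) = e y"
    if y: "y \<in> space (marg i)" for y
    unfolding e_def L2_inner_def
    using y C.space_kernel_eq[OF y]
    by (intro Bochner_Integration.integral_cong) (simp_all add: kernel_op_component_update[OF i _ _ L2_measurable[OF g]])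
  show "integrable (marg i) e"
    by (rule iffD1[OF Bochner_Integration.integrable_cong[OF refl e] integrable_disintegrate[OF i int]])
  have "(\<integral>x. g x * kernel_op (component i) g x \<partial>\<pi>) = (\<integral>y. e y \<partial>marg i)"
    unfolding integral_disintegrate[OF i int] by (intro Bochner_Integration.integral_cong refl e)
  then show "L2_inner \<pi> g (kernel_op (component i) g) = (\<integral>y. e y \<partial>marg i)"
    by (simp add: L2_inner_def)
qed

lemma
  assumes i: "i \<in> {1..n}" and g: "g \<in> L2 \<pi>"
  shows integrable_fibre_energy: "integrable (marg i) (\<lambda>y. energy (\<pi>c i y) (Q i y) (\<lambda>z. g (y(i := z))))"
    and component_energy: "energy \<pi> (component i) g = (\<integral>y. energy (\<pi>c i y) (Q i y) (\<lambda>z. g (y(i := z))) \<partial>marg i)"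
proof -
  have int: "integrable \<pi> (\<lambda>x. g x * g x)"
    by (rule L2_integrable_mult[OF g g])
  note norm = integrable_disintegrate[OF i int] integral_disintegrate[OF i int]
  show "integrable (marg i) (\<lambda>y. energy (\<pi>c i y) (Q i y) (\<lambda>z. g (y(i := z))))"
    unfolding energy_def
    by (rule Bochner_Integration.integrable_diff[OF _ integrable_component_form[OF i g]])
       (use norm in \<open>simp add: L2_inner_def\<close>)
  show "energy \<pi> (component i) g = (\<integral>y. energy (\<pi>c i y) (Q i y) (\<lambda>z. g (y(i := z))) \<partial>marg i)"
    unfolding energy_def component_form[OF i g]
    by (subst Bochner_Integration.integral_diff[OF _ integrable_component_form[OF i g]])
       (use norm in \<open>simp_all add: L2_inner_def\<close>)
qed

lemma scan_energy:
  assumes g: "g \<in> L2 \<pi>"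
  shows "energy \<pi> scan g = (\<Sum>i=1..n. p i * (\<integral>y. energy (\<pi>c i y) (Q i y) (\<lambda>z. g (y(i := z))) \<partial>marg i))"
proof -
  \<comment> \<open>The total weight 1 lets the squared norm be shared out among the coordinates,
    giving each form its own diagonal term.\<close>
  have "energy \<pi> scan g = (\<Sum>i=1..n. p i) * L2_inner \<pi> g g - (\<Sum>i=1..n. p i * L2_inner \<pi> g (kernel_op (component i) g))"
    by (simp only: energy_def scan_form[OF g] p_sum mult_1)
  also have "\<dots> = (\<Sum>i=1..n. p i * energy \<pi> (component i) g)"
    by (simp only: energy_def sum_distrib_right sum_subtractf[symmetric] right_diff_distrib)
  also have "\<dots> = (\<Sum>i=1..n. p i * (\<integral>y. energy (\<pi>c i y) (Q i y) (\<lambda>z. g (y(i := z))) \<partial>marg i))"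
    by (intro sum.cong refl arg_cong2[where f = "(*)"] component_energy g)
  finally show ?thesis .
qed

end

text \<open>A fibre kernel that ignores its argument is reversible because its joint law is the
  product of the target with itself.\<close>

lemma (in gibbs) exact_hybrid: "hybrid_gibbs \<pi> n B \<pi>c p (\<lambda>i y z. \<pi>c i y)"
proof (unfold_locales)
  fix i y assume i: "i \<in> {1..n}" and y: "y \<in> space (prod_space_minus n B i)"
  interpret C: prob_kernel "marg i" "B i" "\<pi>c i" by (rule prob_kernel_cond[OF i])
  show "markov_kernel (B i) (\<lambda>z. \<pi>c i y)"
    unfolding markov_kernel_def
    by (rule measurable_const) (use measurable_space[OF C.kernel, of y] y in simp)
  show "reversible_kernel (\<pi>c i y) (\<lambda>z. \<pi>c i y)"
    unfolding reversible_kernel_def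
    by (intro ballI) (simp add: nn_integral_cmult_indicator, rule mult.commute)
next
  fix i A assume i: "i \<in> {1..n}" and A: "A \<in> sets (B i)"
  interpret C: prob_kernel "marg i" "B i" "\<pi>c i" by (rule prob_kernel_cond[OF i])
  have "(\<lambda>y. measure (\<pi>c i y) A) \<in> borel_measurable (prod_space_minus n B i)"
    using measurable_compose[OF C.kernel measurable_measure_prob_algebra[OF A]]
    by (simp cong: measurable_cong_sets)
  from measurable_compose[OF drop_coord_measurable this]
  show "(\<lambda>x. measure (\<pi>c i (drop_coord n i x)) A) \<in> borel_measurable (prod_space n B)"
    by (simp add: measurable_cong_sets[OF sets_Pi refl])
qed

lemma (in gibbs) gibbs_kernel_eq: "gibbs_kernel n B p \<pi>c = hybrid_gibbs_kernel n B p (\<lambda>i y z. \<pi>c i y)"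
  by (simp add: gibbs_kernel_def hybrid_gibbs_kernel_def)

lemma (in reversible_chain) contractive_chainI:
  assumes "0 < r" "r < 1"
    and "\<And>g. g \<in> L2_0 \<omega> \<Longrightarrow> \<bar>L2_inner \<omega> g (kernel_op K g)\<bar> \<le> r * L2_inner \<omega> g g"
  shows "contractive_chain \<omega> K r"
  using form_bound_imp_operator_bound[OF assms(1) _ assms(3)] assms(1,2)
  by unfold_locales auto

text \<open>On each fibre the form of the exact update is the square of the conditional mean of
  \<open>g\<close>. This positivity later gives the energy bound
  \<open>E_T(g) \<le> ||g||^2\<close>, and hence control of the hybrid kernel near -1.\<close>

lemma (in gibbs) exact_form_nonneg:
  assumes g: "g \<in> L2 \<pi>"
  shows "0 \<le> L2_inner \<pi> g (kernel_op (gibbs_kernel n B p \<pi>c) g)"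
proof -
  interpret E: hybrid_gibbs \<pi> n B \<pi>c p "\<lambda>i y z. \<pi>c i y" by (rule exact_hybrid)
  have "0 \<le> L2_inner \<pi> g (kernel_op (E.component i) g)" if "i \<in> {1..n}" for i
    unfolding E.component_form[OF that g]
    by (rule Bochner_Integration.integral_nonneg) (simp add: L2_inner_def kernel_op_def)
  then show ?thesis
    unfolding gibbs_kernel_eq E.scan_form[OF g]
    by (intro sum_nonneg mult_nonneg_nonneg p_nonneg)
qed

section \<open>Comparison of the two energies and of the asymptotic variances\<close>

context hybrid_gibbs
begin

text \<open>The ratio bounds are applied to the sections of one global \<open>g\<close>, which are
  square integrable on almost every fibre. Integrating over fibres and averaging with nonnegative
  weights preserves both inequalities.\<close>

lemma scan_energy_bounds:
  assumes bounds: "\<And>i. i \<in> {1..n} \<Longrightarrow>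
        AE y in marg i. \<forall>g \<in> L2_0 (\<pi>c i y). \<not> (AE z in \<pi>c i y. g z = 0) \<longrightarrow>
            c1 \<le> dirichlet_form (\<pi>c i y) (Q i y) g / (L2_norm (\<pi>c i y) g)\<^sup>2 \<and>
            dirichlet_form (\<pi>c i y) (Q i y) g / (L2_norm (\<pi>c i y) g)\<^sup>2 \<le> c2"
    and g: "g \<in> L2 \<pi>"
  shows "c1 * energy \<pi> (gibbs_kernel n B p \<pi>c) g \<le> energy \<pi> scan g"
    and "energy \<pi> scan g \<le> c2 * energy \<pi> (gibbs_kernel n B p \<pi>c) g"
proof -
  interpret E: hybrid_gibbs \<pi> n B \<pi>c p "\<lambda>i y z. \<pi>c i y" by (rule exact_hybrid)
  let ?e = "\<lambda>i y. energy (\<pi>c i y) (\<lambda>_. \<pi>c i y) (\<lambda>z. g (y(i := z)))"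
  let ?h = "\<lambda>i y. energy (\<pi>c i y) (Q i y) (\<lambda>z. g (y(i := z)))"
  have ae: "AE y in marg i. c1 * ?e i y \<le> ?h i y \<and> ?h i y \<le> c2 * ?e i y" if i: "i \<in> {1..n}" for i
    using bounds[OF i] AE_L2_fibre[OF i g] AE_space
  proof eventually_elim
    case (elim y)
    interpret F: reversible_chain "\<pi>c i y" "Q i y"
      using elim(3) by (intro reversible_fibre i) simp
    \<comment> \<open>The variance in the fibre bounds is recognised as the energy of the exact
      update.\<close>
    note e = energy_const_kernel[OF F.prob_space_axioms elim(2)]
    show ?case
      using F.energy_bounds_variance[OF elim(2), of c1 c2] elim(1) unfolding e by blast
  qed
  note int = integrable_fibre_energy[OF _ g] E.integrable_fibre_energy[OF _ g]
  have lower: "c1 * (\<integral>y. ?e i y \<partial>marg i) \<le> (\<integral>y. ?h i y \<partial>marg i)" if i: "i \<in> {1..n}" for i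
    using ae[OF i] int[OF i]
    by (subst integral_mult_right_zero[symmetric], intro integral_mono_AE) (auto elim: AE_mp)
  have upper: "(\<integral>y. ?h i y \<partial>marg i) \<le> c2 * (\<integral>y. ?e i y \<partial>marg i)" if i: "i \<in> {1..n}" for i
    using ae[OF i] int[OF i]
    by (subst integral_mult_right_zero[symmetric], intro integral_mono_AE) (auto elim: AE_mp)
  show "c1 * energy \<pi> (gibbs_kernel n B p \<pi>c) g \<le> energy \<pi> scan g"
    unfolding gibbs_kernel_eq scan_energy[OF g] E.scan_energy[OF g] sum_distrib_left mult.left_commute[of c1]
    by (intro sum_mono mult_left_mono lower p_nonneg)
  show "energy \<pi> scan g \<le> c2 * energy \<pi> (gibbs_kernel n B p \<pi>c) g"
    unfolding gibbs_kernel_eq scan_energy[OF g] E.scan_energy[OF g] sum_distrib_left mult.left_commute[of c2]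
    by (intro sum_mono mult_left_mono upper p_nonneg)
qed

end

text \<open>\<open>asymp_var\<close> is defined by \<open>lim\<close>, whose value is meaningful
  only for a convergent sequence; the conclusion therefore includes the convergence of both scaled
  variances.\<close>

theorem corollary5:
  fixes n :: nat
    and X :: "nat \<Rightarrow> 'a topology"
    and B :: "nat \<Rightarrow> 'a measure"
    and \<pi> :: "(nat \<Rightarrow> 'a) measure"
    and \<pi>c :: "nat \<Rightarrow> (nat \<Rightarrow> 'a) \<Rightarrow> 'a measure"
    and Q :: "nat \<Rightarrow> (nat \<Rightarrow> 'a) \<Rightarrow> 'a \<Rightarrow> 'a measure"
    and p :: "nat \<Rightarrow> real"
    and c1 c2 :: real
    and T T_hat :: "(nat \<Rightarrow> 'a) \<Rightarrow> (nat \<Rightarrow> 'a) measure"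
    and f :: "(nat \<Rightarrow> 'a) \<Rightarrow> real"
  assumes polish: "\<And>i. i \<in> {1..n} \<Longrightarrow> polish_topology (X i)"
    and B_def: "\<And>i. B i = borel_of_topology (X i)"
    and prob: "prob_space \<pi>"
    and sets_Pi: "sets \<pi> = sets (prod_space n B)"
    and cond: "\<And>i. i \<in> {1..n} \<Longrightarrow> regular_cond_distr n B \<pi> i (\<pi>c i)"
    and Q_kernel: "\<And>i y. i \<in> {1..n} \<Longrightarrow> y \<in> space (prod_space_minus n B i) \<Longrightarrow>
        markov_kernel (B i) (Q i y)"
    and Q_reversible: "\<And>i y. i \<in> {1..n} \<Longrightarrow> y \<in> space (prod_space_minus n B i) \<Longrightarrow>
        reversible_kernel (\<pi>c i y) (Q i y)"
    and Q_measurable: "\<And>i A. i \<in> {1..n} \<Longrightarrow> A \<in> sets (B i) \<Longrightarrow>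
        (\<lambda>x. measure (Q i (drop_coord n i x) (x i)) A) \<in> borel_measurable (prod_space n B)"
    and p_nonneg: "\<And>i. i \<in> {1..n} \<Longrightarrow> 0 \<le> p i"
    and p_sum: "(\<Sum>i=1..n. p i) = 1"
    and T_def: "T = gibbs_kernel n B p \<pi>c"
    and T_hat_def: "T_hat = hybrid_gibbs_kernel n B p Q"
    and c1: "c1 \<in> {0<..<2}"
    and c2: "c2 \<in> {0<..<2}"
    and bounds: "\<And>i. i \<in> {1..n} \<Longrightarrow>
        AE y in marginal_minus n B \<pi> i.
          \<forall>g \<in> L2_0 (\<pi>c i y). \<not> (AE z in \<pi>c i y. g z = 0) \<longrightarrow>
            c1 \<le> dirichlet_form (\<pi>c i y) (Q i y) g / (L2_norm (\<pi>c i y) g)\<^sup>2 \<and>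
            dirichlet_form (\<pi>c i y) (Q i y) g / (L2_norm (\<pi>c i y) g)\<^sup>2 \<le> c2"
    and T_norm: "kernel_norm \<pi> T < 1"
    and f: "f \<in> L2_0 \<pi>"
  shows "convergent (scaled_var \<pi> T f) \<and> convergent (scaled_var \<pi> T_hat f) \<and>
    inverse c2 * asymp_var \<pi> T f + (inverse c2 - 1) * (L2_norm \<pi> f)\<^sup>2 \<le> asymp_var \<pi> T_hat f \<and>
    asymp_var \<pi> T_hat f \<le> inverse c1 * asymp_var \<pi> T f + (inverse c1 - 1) * (L2_norm \<pi> f)\<^sup>2"
proof -
  interpret G: gibbs \<pi> n B \<pi>c p
    using prob sets_Pi cond p_nonneg p_sum by (simp add: gibbs_def gibbs_axioms_def)
  interpret E: hybrid_gibbs \<pi> n B \<pi>c p "\<lambda>i y z. \<pi>c i y"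
    by (rule G.exact_hybrid)
  interpret H: hybrid_gibbs \<pi> n B \<pi>c p Q
    using Q_kernel Q_reversible Q_measurable by unfold_locales auto
  have T: "T = E.scan"
    by (simp only: T_def G.gibbs_kernel_eq)
  have c: "0 < c1" "c1 < 2" "0 < c2" "c2 < 2"
    using c1 c2 by auto
  have lower: "c1 * energy \<pi> T g \<le> energy \<pi> T_hat g"
    and upper: "energy \<pi> T_hat g \<le> c2 * energy \<pi> T g" if "g \<in> L2_0 \<pi>" for g
    using H.scan_energy_bounds[OF bounds L2_0_imp_L2[OF that]] by (simp_all only: T_def T_hat_def)
  have T_nonneg: "0 \<le> L2_inner \<pi> g (kernel_op T g)" if "g \<in> L2_0 \<pi>" for g
    unfolding T_def by (rule G.exact_form_nonneg[OF L2_0_imp_L2[OF that]])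

  \<comment> \<open>The value 1/2 is an arbitrary number in the unit interval that keeps the bound
    positive if the norm vanishes.\<close>
  define k where "k = max (1 / 2) (kernel_norm \<pi> T)"
  have k: "0 < k" "k < 1" "kernel_norm \<pi> T \<le> k"
    using T_norm by (auto simp: k_def)
  have T_le: "L2_inner \<pi> g (kernel_op T g) \<le> k * L2_inner \<pi> g g" if "g \<in> L2_0 \<pi>" for g
    using E.scan.kernel_norm_form_bound[OF that, of k] k by (simp add: T)
  have chain_T: "contractive_chain \<pi> T k"
    unfolding T
    by (rule E.scan.contractive_chainI) (use k T_le T_nonneg in \<open>auto simp: T\<close>)

  \<comment> \<open>The second entry bounds the form of the hybrid kernel from above, through
    \<open>E_H \<ge> c1 E_T \<ge> c1 (1 - k) ||g||^2\<close>. The third bounds its negative, through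
    \<open>E_H \<le> c2 E_T \<le> c2 ||g||^2\<close>. The first again ensures positivity.\<close>
  define r where "r = max (1 / 2) (max (1 - c1 * (1 - k)) (c2 - 1))"
  have "0 < c1 * (1 - k)"
    using c k by simp
  then have r: "0 < r" "r < 1" "1 - c1 * (1 - k) \<le> r" "c2 - 1 \<le> r"
    using c by (auto simp: r_def)
  have "\<bar>L2_inner \<pi> g (kernel_op T_hat g)\<bar> \<le> r * L2_inner \<pi> g g" if g: "g \<in> L2_0 \<pi>" for g
  proof -
    let ?N = "L2_inner \<pi> g g"
    have "c1 * ((1 - k) * ?N) \<le> c1 * energy \<pi> T g"
      using T_le[OF g] c by (intro mult_left_mono) (auto simp: energy_def algebra_simps)
    with lower[OF g] have "L2_inner \<pi> g (kernel_op T_hat g) \<le> (1 - c1 * (1 - k)) * ?N"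
      by (simp add: energy_def algebra_simps)
    also have "\<dots> \<le> r * ?N"
      by (intro mult_right_mono r L2_inner_nonneg)
    finally have 1: "L2_inner \<pi> g (kernel_op T_hat g) \<le> r * ?N" .
    have "c2 * energy \<pi> T g \<le> c2 * ?N"
      using T_nonneg[OF g] c by (intro mult_left_mono) (auto simp: energy_def)
    with upper[OF g] have "- L2_inner \<pi> g (kernel_op T_hat g) \<le> (c2 - 1) * ?N"
      by (simp add: energy_def algebra_simps)
    also have "\<dots> \<le> r * ?N"
      by (intro mult_right_mono r L2_inner_nonneg)
    finally show ?thesis
      using 1 by simp
  qed
  then have chain_T_hat: "contractive_chain \<pi> T_hat r"
    unfolding T_hat_def using r by (intro H.scan.contractive_chainI) auto

  interpret T: contractive_chain \<pi> T k by (rule chain_T)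
  interpret T_hat: contractive_chain \<pi> T_hat r by (rule chain_T_hat)
  let ?S = "suminf (autocov \<pi> T f)" and ?S_hat = "suminf (autocov \<pi> T_hat f)"
  have "?S \<le> c2 * ?S_hat"
    by (rule suminf_autocov_mono[OF chain_T chain_T_hat c(3) upper f])
  then have "inverse c2 * ?S \<le> ?S_hat"
    using c by (simp add: field_simps)
  moreover have "?S_hat \<le> inverse c1 * ?S"
  proof (rule suminf_autocov_mono[OF chain_T_hat chain_T _ _ f])
    show "energy \<pi> T g \<le> inverse c1 * energy \<pi> T_hat g" if "g \<in> L2_0 \<pi>" for g
      using lower[OF that] c by (simp add: field_simps)
  qed (use c in simp)
  \<comment> \<open>Substituting \<open>2 S = var + ||f||^2\<close> on both sides produces the
    additive terms \<open>(1 / c - 1) ||f||^2\<close>.\<close>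
  ultimately show ?thesis
    using T.convergent_scaled_var[OF f] T_hat.convergent_scaled_var[OF f]
    unfolding T.asymp_var_eq[OF f] T_hat.asymp_var_eq[OF f]
    by (simp add: algebra_simps)
qed

end
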